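(* Let $S\ge 2$ and $2\le N<K$ be integers, and consider the cache-aided multi-user private information retrieval problem with $S$ databases, $N$ files and $K$ users, each with a cache of size $ML$ bits where $M=\frac{NS^{N-1}-q}{KS^{N-1}}$, in which each file is demanded by at least one user. The proposed scheme (described in the context) achieves the rate $$R=\frac{N}{K}\left[\frac{q}{S^{N-1}}+K-N\right],$$ i.e., every user $u\in[K]$ can recover its demanded file $W_{d_u}$ from the answers of all databases together with its own cache content, and the total number $D$ of bits transmitted by all databases satisfies $D/L=R$.
   Context: Notation: $[n]=\{1,\dots,n\}$; $\oplus$ and sums are bitwise XOR. Problem. There are $S$ non-colluding databases, each storing the same $N$ files $W_1,\dots,W_N$ of $L$ bits each, and $K$ users, each with a cache of $ML$ bits. Caches are filled (placement phase) before the demands are known. Then user $u$ demands $W_{d_u}$, $d_u\in[N]$; the demand vector is $\theta=(d_1,\dots,d_K)$. The users cooperatively generate a query set $Q_s$ for each database $s\in[S]$; database $s$ replies with the answers $A_s$, received by all users. With $D$ the total number of bits transmitted by the databases in the delivery phase, the rate is $R=D/L$. Parameters. For $k\in[N]$: $g(S,k)=\frac{S-1}{S}[(-1)^{k-1}+(S-1)^{k-2}]$, $f(S,k)=\frac1S[(-1)^k+(S-1)^{k-1}]$; $\phi_1(S,k)=g(S,k)$ and $\phi_s(S,k)=f(S,k)$ for $2\le s\le S$; $\psi_s(S,k)=\left\lceil\frac{k(N-1)}{N}\phi_s(S,k)\right\rceil$; $q=\sum_{k=1}^N\sum_{s=1}^S\binom Nk\psi_s(S,k)$; $H=q-(N-1)S^{N-1}$.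 For $i,d\in[N]$: $\mathcal F_s^{i,d}(k)=\binom{N-1}{k-1}\phi_s(S,k)$ if $i\ne d$, and $\mathcal F_s^{d,d}(k)=\binom Nk\psi_s(S,k)-(N-1)\binom{N-1}{k-1}\phi_s(S,k)$. Subpacketization. $L$ is a multiple of $KS^{N-1}$. Each file $W_i$ is divided into $K$ equal subfiles $W_{i,1},\dots,W_{i,K}$, and each $W_{i,j}$ into $S^{N-1}$ equal subsubfiles $W_{i,j}^1,\dots,W_{i,j}^{S^{N-1}}$. Placement. A database broadcasts $Z=\{W_{1,j}^t\oplus\cdots\oplus W_{N,j}^t: j\in[K],\ H+1\le t\le S^{N-1}\}$. The users cooperatively generate a random permutation $(p_1,\dots,p_K)$ of $[K]$ (unknown to the databases), and user $u$ stores $Z_u=\{W_{1,p_u}^t\oplus\cdots\oplus W_{N,p_u}^t: H+1\le t\le S^{N-1}\}$. General query procedure. Let $\omega_1(x),\dots,\omega_N(x)$, $x\in[S^{N-1}]$, be symbols of the size of a subsubfile, $a^i=(a^i_1,\dots,a^i_{S^{N-1}})$, $i\in[N]$, permutations of $[S^{N-1}]$, and let multiplicities $m_s(k)$ and counts $n_s^i(k)$ be given. Queries are sets of symbols $\omega_i(x)$ with distinct $i$; a query with $k$ elements is a $k$-sum. Initialize $Q'_1=\{\{\omega_i(a^i_1)\}:i\in[N]\}$, $Q'_s=\emptyset$ for $s\ge2$, $t_i=1$ for all $i$. For $k=2,\dots,N$: set $T_i=t_i$ for all $i$; for $s=1,\dots,S$: let $\mathcal C$ be the multiset containing every $k$-subset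 of $[N]$ exactly $m_s(k)$ times and $\mathcal T=\emptyset$; for $i=1,\dots,N$, repeat $n_s^i(k)$ times the following step. (a) If some $U\in\mathcal C$ contains $i$: increase $t_i$ by one, add to $Q'_s$ the query consisting of $\omega_i(a^i_{t_i})$ and, for every $u\in U\setminus\{i\}$, some $\omega_u(a^u_\tau)$ with $\tau\le T_u$; move $U$ from $\mathcal C$ to $\mathcal T$. (b) Otherwise: choose $U\in\mathcal C$, $V\in\mathcal T$ with corresponding query $q'=\{\omega_v(a^v_{t'_v}):v\in V\}\in Q'_s$, and $v_1\in U\cap V$, such that $i\in V$ and $t'_{v_1}>T_{v_1}$; add to $Q'_s$ the query consisting of $\omega_{v_1}(a^{v_1}_{t'_{v_1}})$ and, for every $u\in U\setminus\{v_1\}$, some $\omega_u(a^u_\tau)$ with $\tau\le T_u$; increase $t_i$ by one; in $q'$ replace the symbol of $\omega_i$ by $\omega_i(a^i_{t_i})$ and that of $\omega_{v_1}$ by some $\omega_{v_1}(a^{v_1}_\tau)$ with $\tau\le T_{v_1}$; move $U$ from $\mathcal C$ to $\mathcal T$. The indices $\tau$ are chosen so as to maintain symmetry in the repetition of symbols of every $\omega_i$, $i\in[N]$, in the query sets $Q'_s$. The output is $Q'_1,\dots,Q'_S$. QSet1$(j;a^1,\dots,a^N;d)$ is this procedure with $\omega_i(x)=W_{i,j}^x$, $m_s(k)=\psi_s(S,k)$, $n_s^i(k)=\mathcal F_s^{i,d}(k)$. QSet2$(\omega_1,\dots,\omega_N;a^1,\dots,a^N)$ is this procedure with $m_s(k)=k\,\phi_s(S,k)$,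 $n_s^i(k)=\binom{N-1}{k-1}\phi_s(S,k)$. Delivery ($N<K$, every file demanded by at least one user). Choose a base set $\mathcal B\subseteq[K]$ with $|\mathcal B|=N$ and $\{d_c:c\in\mathcal B\}=[N]$. For each $c\in\mathcal B$ the users generate random permutations $P^{c1},\dots,P^{cN}$ of $[S^{N-1}]$ such that the entries of $P^{cd_c}$ in positions $H+1,\dots,S^{N-1}$ are $H+1,\dots,S^{N-1}$ in this order, and run QSet1$(p_c;P^{c1},\dots,P^{cN};d_c)$. For each $c\in[K]\setminus\mathcal B$ the users generate a one-to-one map $\rho=(\rho^1,\dots,\rho^N)$ from $[N]$ to $\mathcal B$ with $d_{\rho^j}=j$ for $j=d_c$ and $d_{\rho^j}\ne j$ for all $j\in[N]\setminus\{d_c\}$, and random permutations $P^{c1},\dots,P^{cN}$ of $[S^{N-1}]$, and run QSet2 with $\omega_i(x)=W_{i,p_{\rho^i}}^x\oplus W_{i,p_c}^x$ and $a^i=P^{ci}$. In both cases $Q^c_s$ is the collection of the XOR-sums of the elements of each query in the output $Q'_s$. The query set for database $s$ is $Q_s=\bigcup_{c=1}^KQ^c_s$; the answer to each query is the requested sum, which has the size of one subsubfile ($L/(KS^{N-1})$ bits).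
   Formalization: For N=2 the one-to-one maps ρ that the scheme requires for users outside the base set do not exist, so the scheme is undefined there; the theorem assumes such maps are given and therefore has content only for N≥3. *)

theory Defs
  imports Complex_Main "HOL-Library.Z2" "HOL-Library.FuncSet" "HOL-Library.Multiset"
    "HOL-Combinatorics.Permutations"
begin

section \<open>Parameters\<close>

text \<open>\<open>S\<close> databases, \<open>N\<close> files, \<open>K\<close> users, \<open>L\<close> bits per file; every index is 1-based.\<close>

definition g_par :: "nat \<Rightarrow> nat \<Rightarrow> real" where
  "g_par S k = (real S - 1) / real S * ((- 1) ^ (k - 1) + (real S - 1) powi (int k - 2))"

definition f_par :: "nat \<Rightarrow> nat \<Rightarrow> real" where
  "f_par S k = 1 / real S * ((- 1) ^ k + (real S - 1) ^ (k - 1))"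

text \<open>The two formulas have values in the natural numbers, so taking the floor loses nothing; see
  \<open>phi_exact\<close> below.\<close>

definition phi :: "nat \<Rightarrow> nat \<Rightarrow> nat \<Rightarrow> nat" where
  "phi S s k = nat \<lfloor>if s = 1 then g_par S k else f_par S k\<rfloor>"

definition psi :: "nat \<Rightarrow> nat \<Rightarrow> nat \<Rightarrow> nat \<Rightarrow> nat" where
  "psi N S s k = nat \<lceil>real k * (real N - 1) / real N * real (phi S s k)\<rceil>"

definition q_par :: "nat \<Rightarrow> nat \<Rightarrow> nat" where
  "q_par N S = (\<Sum>k=1..N. \<Sum>s=1..S. (N choose k) * psi N S s k)"

text \<open>The subtractions in \<open>H_par\<close> and \<open>F_par\<close> are never truncated; see \<open>H_par_exact\<close> and
  \<open>F_par_exact\<close>.\<close>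

definition H_par :: "nat \<Rightarrow> nat \<Rightarrow> nat" where
  "H_par N S = q_par N S - (N - 1) * S ^ (N - 1)"

definition F_par :: "nat \<Rightarrow> nat \<Rightarrow> nat \<Rightarrow> nat \<Rightarrow> nat \<Rightarrow> nat \<Rightarrow> nat" where
  "F_par N S d s i k =
     (if i \<noteq> d then ((N - 1) choose (k - 1)) * phi S s k
      else (N choose k) * psi N S s k - (N - 1) * ((N - 1) choose (k - 1)) * phi S s k)"

lemma f_par_Suc:
  assumes "S \<ge> 2" "k \<ge> 1"
  shows "f_par S (Suc k) = (real S - 1) * f_par S k - (- 1) ^ k"
proof -
  obtain m where k: "k = Suc m" using assms(2) by (cases k) auto
  show ?thesis using assms(1) by (simp add: f_par_def k field_simps)
qed

lemma f_par_Ints: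
  assumes "S \<ge> 2" "k \<ge> 1"
  shows "f_par S k \<in> \<int>"
  using assms(2)
proof (induction k rule: dec_induct)
  case base
  then show ?case by (simp add: f_par_def)
next
  case (step k)
  have "real S - 1 \<in> \<int>" by simp
  then show ?case using f_par_Suc[OF assms(1) step.hyps(1)] step.IH by simp
qed

lemma f_par_nonneg:
  assumes "S \<ge> 2"
  shows "f_par S k \<ge> 0"
proof -
  have "1 \<le> (real S - 1) ^ (k - 1)" using assms by (intro one_le_power) simp
  moreover have "(- 1 :: real) ^ k \<ge> - 1" by (cases "even k") auto
  ultimately show ?thesis by (simp add: f_par_def)
qed

lemma g_par_1:
  assumes "S \<ge> 2"
  shows "g_par S 1 = 1"
  using assms by (simp add: g_par_def power_int_minus field_simps)

lemma g_par_eq_f_par: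
  assumes "S \<ge> 2" "k \<ge> 2"
  shows "g_par S k = (real S - 1) * f_par S (k - 1)"
proof -
  obtain m where k: "k = m + 2" using assms(2) by (metis add.commute le_Suc_ex)
  have "(real S - 1) powi (int k - 2) = (real S - 1) ^ m" by (simp add: k)
  then show ?thesis by (simp add: g_par_def f_par_def k)
qed

lemma phi_exact:
  assumes "S \<ge> 2" "k \<ge> 1"
  shows "real (phi S s k) = (if s = 1 then g_par S k else f_par S k)"
proof -
  have "g_par S k \<in> \<int> \<and> g_par S k \<ge> 0"
  proof (cases "k = 1")
    case True
    then show ?thesis using g_par_1[OF assms(1)] by simp
  next
    case False
    then have "k \<ge> 2" using assms(2) by simp
    moreover have "real S - 1 \<in> \<int>" by simp
    ultimately show ?thesis
      using g_par_eq_f_par[of S k] f_par_Ints[of S "k - 1"] f_par_nonneg[of S "k - 1"] assms(1) by simp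
  qed
  moreover have "f_par S k \<in> \<int> \<and> f_par S k \<ge> 0"
    using f_par_Ints f_par_nonneg assms by blast
  ultimately show ?thesis
    unfolding phi_def by (auto elim!: Ints_cases)
qed

lemma F_par_exact:
  assumes "N \<ge> 1" "k \<ge> 1"
  shows "(N - 1) * ((N - 1) choose (k - 1)) * phi S s k \<le> (N choose k) * psi N S s k"
proof -
  have c: "k * (N choose k) = N * ((N - 1) choose (k - 1))"
    using assms(2) by (intro times_binomial_minus1_eq) simp
  have N1: "real (N - 1) = real N - 1" using assms(1) by (simp add: of_nat_diff)
  have "real ((N - 1) * ((N - 1) choose (k - 1)) * phi S s k)
      = (real N - 1) / real N * (real N * real ((N - 1) choose (k - 1))) * real (phi S s k)"
    using assms(1) by (simp add: N1)
  also have "\<dots> = (real N - 1) / real N * real (k * (N choose k)) * real (phi S s k)"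
    by (simp only: c of_nat_mult)
  also have "\<dots> = real (N choose k) * (real k * (real N - 1) / real N * real (phi S s k))"
    by simp
  also have "\<dots> \<le> real (N choose k) * real (psi N S s k)"
    unfolding psi_def by (intro mult_left_mono) (auto simp: real_nat_ceiling_ge)
  finally show ?thesis by (simp only: of_nat_mult[symmetric] of_nat_le_iff)
qed

lemma sum_phi:
  assumes "S \<ge> 2" "k \<ge> 1"
  shows "(\<Sum>s=1..S. phi S s k) = (S - 1) ^ (k - 1)"
proof -
  have "real (\<Sum>s=1..S. phi S s k) = g_par S k + (\<Sum>s=2..S. f_par S k)"
    using assms by (simp add: phi_exact sum.atLeast_Suc_atMost numeral_2_eq_2 del: sum_constant)
  also have "\<dots> = g_par S k + (real S - 1) * f_par S k"
    using assms(1) by (simp add: of_nat_diff)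
  also have "\<dots> = (real S - 1) ^ (k - 1)"
  proof (cases "k = 1")
    case True
    then show ?thesis using g_par_1[OF assms(1)] by (simp add: f_par_def)
  next
    case False
    then have k2: "k \<ge> 2" using assms(2) by simp
    have "f_par S k = (real S - 1) * f_par S (k - 1) - (- 1) ^ (k - 1)"
      using f_par_Suc[of S "k - 1"] k2 assms(1) by simp
    then have "(real S - 1) * f_par S (k - 1) + (real S - 1) * f_par S k
        = real S * f_par S k + (- 1) ^ (k - 1)"
      by (simp add: algebra_simps)
    also have "\<dots> = (real S - 1) ^ (k - 1)"
      using assms k2 by (cases k) (simp_all add: f_par_def)
    finally show ?thesis using g_par_eq_f_par[OF assms(1) k2] by simp
  qed
  also have "\<dots> = real ((S - 1) ^ (k - 1))" using assms(1) by (simp add: of_nat_diff)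
  finally show ?thesis by (simp only: of_nat_eq_iff)
qed

lemma sum_binomial_phi:
  assumes "S \<ge> 2" "N \<ge> 1"
  shows "(\<Sum>k=1..N. \<Sum>s=1..S. ((N - 1) choose (k - 1)) * phi S s k) = S ^ (N - 1)"
proof -
  have "(\<Sum>k=1..N. \<Sum>s=1..S. ((N - 1) choose (k - 1)) * phi S s k)
      = (\<Sum>k=1..N. ((N - 1) choose (k - 1)) * (S - 1) ^ (k - 1))"
    by (intro sum.cong) (auto simp: sum_distrib_left[symmetric] sum_phi[OF assms(1), simplified])
  also have "\<dots> = (\<Sum>k\<le>N - 1. ((N - 1) choose k) * (S - 1) ^ k)"
    by (rule sum.reindex_bij_witness[of _ Suc "\<lambda>k. k - 1"]) (use assms(2) in auto)
  also have "\<dots> = ((S - 1) + 1) ^ (N - 1)"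
    by (subst binomial) simp
  finally show ?thesis using assms(1) by simp
qed

lemma H_par_exact:
  assumes "S \<ge> 2" "N \<ge> 1"
  shows "(N - 1) * S ^ (N - 1) \<le> q_par N S"
proof -
  have "(N - 1) * S ^ (N - 1)
      = (\<Sum>k=1..N. \<Sum>s=1..S. (N - 1) * ((N - 1) choose (k - 1)) * phi S s k)"
    by (simp only: sum_binomial_phi[OF assms, symmetric] sum_distrib_left mult.assoc)
  also have "\<dots> \<le> q_par N S"
    unfolding q_par_def using assms(2) by (intro sum_mono F_par_exact) auto
  finally show ?thesis .
qed


section \<open>Files, subpacketization and formal XOR-sums\<close>

text \<open>Bits live in \<open>bit\<close>, the field with two elements, whose addition is XOR.\<close>

definition valid_files :: "nat \<Rightarrow> nat \<Rightarrow> (nat \<Rightarrow> bit list) \<Rightarrow> bool" where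
  "valid_files N L W \<longleftrightarrow> (\<forall>i\<in>{1..N}. length (W i) = L)"

definition block :: "nat \<Rightarrow> nat \<Rightarrow> nat \<Rightarrow> nat \<Rightarrow> nat" where
  "block S N K L = L div (K * S ^ (N - 1))"

text \<open>\<open>subsub S N K L W i j x\<close> is the \<open>x\<close>-th subsubfile of the \<open>j\<close>-th subfile of file \<open>i\<close>.\<close>

definition subsub ::
    "nat \<Rightarrow> nat \<Rightarrow> nat \<Rightarrow> nat \<Rightarrow> (nat \<Rightarrow> bit list) \<Rightarrow> nat \<Rightarrow> nat \<Rightarrow> nat \<Rightarrow> bit list" where
  "subsub S N K L W i j x =
     take (block S N K L) (drop (((j - 1) * S ^ (N - 1) + (x - 1)) * block S N K L) (W i))"

text \<open>A formal XOR-sum of subsubfiles is the set of the labels \<open>(i, j, x)\<close> that occur in it.\<close>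

type_synonym request = "(nat \<times> nat \<times> nat) set"

definition xor_sum :: "nat \<Rightarrow> nat \<Rightarrow> nat \<Rightarrow> nat \<Rightarrow> (nat \<Rightarrow> bit list) \<Rightarrow> request \<Rightarrow> bit list" where
  "xor_sum S N K L W r =
     map (\<lambda>n. \<Sum>(i, j, x)\<in>r. subsub S N K L W i j x ! n) [0..<block S N K L]"


section \<open>Placement\<close>

definition broadcast ::
    "nat \<Rightarrow> nat \<Rightarrow> nat \<Rightarrow> nat \<Rightarrow> (nat \<Rightarrow> bit list) \<Rightarrow> nat \<times> nat \<Rightarrow> bit list" where
  "broadcast S N K L W =
     (\<lambda>(j, t)\<in>{1..K} \<times> {H_par N S + 1..S ^ (N - 1)}.
        xor_sum S N K L W {(i, j, t) |i. i \<in> {1..N}})"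

definition cache ::
    "nat \<Rightarrow> nat \<Rightarrow> nat \<Rightarrow> nat \<Rightarrow> (nat \<Rightarrow> nat) \<Rightarrow> (nat \<Rightarrow> bit list) \<Rightarrow> nat \<Rightarrow> nat \<Rightarrow> bit list" where
  "cache S N K L p W u =
     (\<lambda>t\<in>{H_par N S + 1..S ^ (N - 1)}. broadcast S N K L W (p u, t))"

definition cache_bits ::
    "nat \<Rightarrow> nat \<Rightarrow> nat \<Rightarrow> nat \<Rightarrow> (nat \<Rightarrow> nat) \<Rightarrow> (nat \<Rightarrow> bit list) \<Rightarrow> nat \<Rightarrow> nat" where
  "cache_bits S N K L p W u =
     (\<Sum>t\<in>{H_par N S + 1..S ^ (N - 1)}. length (cache S N K L p W u t))"


section \<open>General query procedure\<close>

text \<open>A query is a partial map: \<open>q i = Some \<tau>\<close> means that it contains the symbol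
  \<open>\<omega>\<^sub>i(a\<^sup>i\<^sub>\<tau>)\<close>; its domain is the corresponding subset of \<open>{1..N}\<close>. Since the \<open>a\<^sup>i\<close> are
  permutations, working with the positions \<open>\<tau>\<close> is the same as working with the symbols.\<close>

type_synonym query = "nat \<rightharpoonup> nat"

definition old_on :: "nat set \<Rightarrow> (nat \<Rightarrow> nat) \<Rightarrow> query \<Rightarrow> bool" where
  "old_on X T q \<longleftrightarrow> (\<forall>u\<in>X. \<exists>\<tau>\<in>{1..T u}. q u = Some \<tau>)"

text \<open>One execution of the inner step for database \<open>s\<close> and file \<open>i\<close>, where \<open>T\<close> holds the values of
  the counters at the beginning of the current round. A state consists of the query sets, the
  counters \<open>t\<close>, the multiset \<open>C\<close> and the set \<open>D\<close> of the queries produced so far for this round and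
  this database; the sets in the second multiset of the procedure, together with their
  corresponding queries, are the \<open>dom q\<close> for \<open>q \<in> D\<close>. The choice of the old positions \<open>\<tau>\<close> is left
  completely free; this covers, for any notion of symmetry, the choices that repeat the symbols of
  all files symmetrically.\<close>

type_synonym state =
  "(nat \<Rightarrow> query set) \<times> (nat \<Rightarrow> nat) \<times> nat set multiset \<times> query set"

inductive query_step :: "nat \<Rightarrow> (nat \<Rightarrow> nat) \<Rightarrow> nat \<Rightarrow> state \<Rightarrow> state \<Rightarrow> bool"
  for s :: nat and T :: "nat \<Rightarrow> nat" and i :: nat
where
  direct:
    "\<lbrakk>U \<in># C; i \<in> U;
      dom q = U; q i = Some (t i + 1); old_on (U - {i}) T q\<rbrakk>
     \<Longrightarrow> query_step s T i
           (Q, t, C, D)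
           (Q(s := insert q (Q s)), t(i := t i + 1), C - {#U#}, insert q D)"
| exchange:
    "\<lbrakk>\<not> (\<exists>U'\<in>#C. i \<in> U');
      U \<in># C; q' \<in> D; v \<in> U \<inter> dom q'; i \<in> dom q'; q' v = Some \<tau>\<^sub>v; \<tau>\<^sub>v > T v;
      dom q = U; q v = Some \<tau>\<^sub>v; old_on (U - {v}) T q;
      \<tau> \<in> {1..T v}; q'' = q'(i \<mapsto> t i + 1, v \<mapsto> \<tau>)\<rbrakk>
     \<Longrightarrow> query_step s T i
           (Q, t, C, D)
           (Q(s := insert q (insert q'' (Q s - {q'}))), t(i := t i + 1), C - {#U#},
            insert q (insert q'' (D - {q'})))"

primrec for_loop :: "('b \<Rightarrow> 'a \<Rightarrow> 'a \<Rightarrow> bool) \<Rightarrow> 'b list \<Rightarrow> 'a \<Rightarrow> 'a \<Rightarrow> bool" where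
  "for_loop R [] = (=)"
| "for_loop R (x # xs) = R x OO for_loop R xs"

text \<open>\<open>m s k\<close> are the multiplicities and \<open>n s i k\<close> the counts.\<close>

definition db_round ::
    "nat \<Rightarrow> (nat \<Rightarrow> nat \<Rightarrow> nat) \<Rightarrow> (nat \<Rightarrow> nat \<Rightarrow> nat \<Rightarrow> nat) \<Rightarrow> nat \<Rightarrow> (nat \<Rightarrow> nat) \<Rightarrow> nat
      \<Rightarrow> (nat \<Rightarrow> query set) \<times> (nat \<Rightarrow> nat) \<Rightarrow> (nat \<Rightarrow> query set) \<times> (nat \<Rightarrow> nat) \<Rightarrow> bool" where
  "db_round N m n k T s = (\<lambda>(Q, t) (Q', t').
     \<exists>C' D'. for_loop (\<lambda>i. query_step s T i ^^ n s i k) [1..<N + 1]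
       (Q, t, repeat_mset (m s k) (mset_set {U. U \<subseteq> {1..N} \<and> card U = k}), {})
       (Q', t', C', D'))"

definition k_round ::
    "nat \<Rightarrow> nat \<Rightarrow> (nat \<Rightarrow> nat \<Rightarrow> nat) \<Rightarrow> (nat \<Rightarrow> nat \<Rightarrow> nat \<Rightarrow> nat) \<Rightarrow> nat
      \<Rightarrow> (nat \<Rightarrow> query set) \<times> (nat \<Rightarrow> nat) \<Rightarrow> (nat \<Rightarrow> query set) \<times> (nat \<Rightarrow> nat) \<Rightarrow> bool" where
  "k_round S N m n k = (\<lambda>(Q, t). for_loop (db_round N m n k t) [1..<S + 1] (Q, t))"

text \<open>\<open>query_procedure S N m n Q'\<close> states that \<open>Q'\<close> is a possible output.\<close>

definition query_procedure ::
    "nat \<Rightarrow> nat \<Rightarrow> (nat \<Rightarrow> nat \<Rightarrow> nat) \<Rightarrow> (nat \<Rightarrow> nat \<Rightarrow> nat \<Rightarrow> nat) \<Rightarrow> (nat \<Rightarrow> query set) \<Rightarrow> bool" where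
  "query_procedure S N m n Q' \<longleftrightarrow>
     (\<exists>t'. for_loop (k_round S N m n) [2..<N + 1]
        (\<lambda>s. if s = 1 then {[i \<mapsto> 1] |i. i \<in> {1..N}} else {}, \<lambda>i. 1) (Q', t'))"

text \<open>The formal XOR-sum of the symbols \<open>\<omega> i (a i \<tau>)\<close> of a query: a label survives iff it occurs an
  odd number of times.\<close>

definition request_of ::
    "(nat \<Rightarrow> nat \<Rightarrow> request) \<Rightarrow> (nat \<Rightarrow> nat \<Rightarrow> nat) \<Rightarrow> query \<Rightarrow> request" where
  "request_of \<omega> a q = {l. odd (card {i \<in> dom q. l \<in> \<omega> i (a i (the (q i)))})}"

definition QSet1 ::
    "nat \<Rightarrow> nat \<Rightarrow> nat \<Rightarrow> (nat \<Rightarrow> nat \<Rightarrow> nat) \<Rightarrow> nat \<Rightarrow> (nat \<Rightarrow> request set) \<Rightarrow> bool" where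
  "QSet1 S N j a d R \<longleftrightarrow>
     (\<exists>Q'. query_procedure S N (psi N S) (F_par N S d) Q' \<and>
       R = (\<lambda>s. request_of (\<lambda>i x. {(i, j, x)}) a ` Q' s))"

definition QSet2 ::
    "nat \<Rightarrow> nat \<Rightarrow> (nat \<Rightarrow> nat \<Rightarrow> request) \<Rightarrow> (nat \<Rightarrow> nat \<Rightarrow> nat) \<Rightarrow> (nat \<Rightarrow> request set) \<Rightarrow> bool" where
  "QSet2 S N \<omega> a R \<longleftrightarrow>
     (\<exists>Q'. query_procedure S N (\<lambda>s k. k * phi S s k)
         (\<lambda>s i k. ((N - 1) choose (k - 1)) * phi S s k) Q' \<and>
       R = (\<lambda>s. request_of \<omega> a ` Q' s))"


section \<open>Delivery\<close>

definition base_set :: "nat \<Rightarrow> nat \<Rightarrow> (nat \<Rightarrow> nat) \<Rightarrow> nat set \<Rightarrow> bool" where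
  "base_set N K d B \<longleftrightarrow> B \<subseteq> {1..K} \<and> card B = N \<and> d ` B = {1..N}"

text \<open>\<open>P c i\<close> is the permutation of user \<open>c\<close> for file \<open>i\<close>, and \<open>\<rho> c\<close> the map of the non-base
  user \<open>c\<close>. Maps \<open>\<rho> c\<close> as required exist iff the set of the \<open>N - 1\<close> files other than \<open>d c\<close> has a
  derangement, hence for \<open>N \<ge> 3\<close> but not for \<open>N = 2\<close>.\<close>

definition user_choices ::
    "nat \<Rightarrow> nat \<Rightarrow> nat \<Rightarrow> (nat \<Rightarrow> nat) \<Rightarrow> nat set
      \<Rightarrow> (nat \<Rightarrow> nat \<Rightarrow> nat \<Rightarrow> nat) \<Rightarrow> (nat \<Rightarrow> nat \<Rightarrow> nat) \<Rightarrow> bool" where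
  "user_choices S N K d B P \<rho> \<longleftrightarrow>
     (\<forall>c\<in>{1..K}. \<forall>i\<in>{1..N}. P c i permutes {1..S ^ (N - 1)}) \<and>
     (\<forall>c\<in>B. \<forall>x\<in>{H_par N S + 1..S ^ (N - 1)}. P c (d c) x = x) \<and>
     (\<forall>c\<in>{1..K} - B. inj_on (\<rho> c) {1..N} \<and> \<rho> c ` {1..N} \<subseteq> B \<and>
        d (\<rho> c (d c)) = d c \<and> (\<forall>j\<in>{1..N} - {d c}. d (\<rho> c j) \<noteq> j))"

text \<open>\<open>Q\<close> is a possible family of query sets for the databases.\<close>

definition delivery_queries ::
    "nat \<Rightarrow> nat \<Rightarrow> nat \<Rightarrow> (nat \<Rightarrow> nat) \<Rightarrow> (nat \<Rightarrow> nat) \<Rightarrow> nat set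
      \<Rightarrow> (nat \<Rightarrow> nat \<Rightarrow> nat \<Rightarrow> nat) \<Rightarrow> (nat \<Rightarrow> nat \<Rightarrow> nat) \<Rightarrow> (nat \<Rightarrow> request set) \<Rightarrow> bool" where
  "delivery_queries S N K p d B P \<rho> Q \<longleftrightarrow>
     (\<exists>Qc. (\<forall>c\<in>B. QSet1 S N (p c) (P c) (d c) (Qc c)) \<and>
           (\<forall>c\<in>{1..K} - B.
              QSet2 S N (\<lambda>i x. sym_diff {(i, p (\<rho> c i), x)} {(i, p c, x)}) (P c) (Qc c)) \<and>
           Q = (\<lambda>s. \<Union>c\<in>{1..K}. Qc c s))"

definition answers ::
    "nat \<Rightarrow> nat \<Rightarrow> nat \<Rightarrow> nat \<Rightarrow> (nat \<Rightarrow> request set) \<Rightarrow> (nat \<Rightarrow> bit list)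
      \<Rightarrow> nat \<Rightarrow> request \<Rightarrow> bit list" where
  "answers S N K L Q W = (\<lambda>s\<in>{1..S}. \<lambda>r\<in>Q s. xor_sum S N K L W r)"

definition delivery_bits ::
    "nat \<Rightarrow> nat \<Rightarrow> nat \<Rightarrow> nat \<Rightarrow> (nat \<Rightarrow> request set) \<Rightarrow> (nat \<Rightarrow> bit list) \<Rightarrow> nat" where
  "delivery_bits S N K L Q W = (\<Sum>s=1..S. \<Sum>r\<in>Q s. length (answers S N K L Q W s r))"

text \<open>User \<open>u\<close> recovers its file: the decoder may depend on everything the users agreed upon (the
  demands, the permutations, the queries), but sees the file contents only through the answers and
  the user's own cache.\<close>

definition recovers ::
    "nat \<Rightarrow> nat \<Rightarrow> nat \<Rightarrow> nat \<Rightarrow> (nat \<Rightarrow> nat) \<Rightarrow> (nat \<Rightarrow> nat) \<Rightarrow> (nat \<Rightarrow> request set) \<Rightarrow> nat \<Rightarrow> bool" where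
  "recovers S N K L p d Q u \<longleftrightarrow>
     (\<exists>dec. \<forall>W. valid_files N L W \<longrightarrow>
        dec (answers S N K L Q W) (cache S N K L p W u) = W (d u))"

end

theory Submission
  imports Defs
begin

text \<open>Every query that a database produces in round \<open>k\<close> contains exactly one symbol not known
  before that round, and each new symbol of that database occurs in exactly one of them, exchange
  steps included. Hence the queries are pairwise distinct, which gives the rate, and reading the
  rounds in order everybody decodes the positions up to the final counters. For a base user \<open>c\<close>
  these are all symbols of the \<open>p\<^sub>c\<close>-th subfiles except the last \<open>S ^ (N - 1) - H\<close> symbols of the
  demanded file; for any other user they are the sums of two subfiles. The cached sums then supply
  the missing symbols: a base user cancels the other files directly, while any other user first
  obtains his own subfile of the undemanded files through the links \<open>\<rho>\<close>.

  Recovery is proved as injectivity: if two contents of the files yield equal answers and caches,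
  then \<open>e\<close>, the bitwise difference of the two contents, is a solution of the corresponding
  homogeneous linear system over \<open>bit\<close>.

  A run of the query procedure exists because the \<open>k\<close>-subsets can be distributed among their
  elements beforehand by Hall's theorem, so that no exchange step is needed.\<close>

section \<open>Rules for bounded loops of relations\<close>

text \<open>The invariant is indexed by the pass about to be made, so it can count the passes
  already completed.\<close>

lemma for_loop_invariant:
  assumes "for_loop R [a..<b] x y" and "a \<le> b" and "P a x"
    and "\<And>i x y. a \<le> i \<Longrightarrow> i < b \<Longrightarrow> R i x y \<Longrightarrow> P i x \<Longrightarrow> P (Suc i) y"
  shows "P b y"
  using assms
proof (induction "b - a" arbitrary: a x)
  case 0
  then show ?case by simp
next
  case (Suc l)
  then have "a < b" by simp
  then obtain z where z: "R a x z" "for_loop R [Suc a..<b] z y"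
    using Suc.prems(1) by (auto simp: upt_conv_Cons)
  show ?case
  proof (rule Suc.hyps(1)[OF _ z(2)])
    show "P (Suc a) z" using Suc.prems(3,4) z(1) \<open>a < b\<close> by blast
    show "P (Suc i) y'" if "Suc a \<le> i" "i < b" "R i x' y'" "P i x'" for i x' y'
      using Suc.prems(4)[OF _ that(2-4)] that(1) by simp
  qed (use Suc.hyps(2) \<open>a < b\<close> in auto)
qed

text \<open>The counterpart for existence: a pass is a relation that may be partial, so the
  invariant must also supply a successor state.\<close>

lemma for_loop_exists:
  assumes "a \<le> b" and "P a x"
    and "\<And>i x. a \<le> i \<Longrightarrow> i < b \<Longrightarrow> P i x \<Longrightarrow> \<exists>y. R i x y \<and> P (Suc i) y"
  shows "\<exists>y. for_loop R [a..<b] x y \<and> P b y"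
  using assms
proof (induction "b - a" arbitrary: a x)
  case 0
  then show ?case by simp
next
  case (Suc l)
  then have "a < b" by simp
  then obtain z where z: "R a x z" "P (Suc a) z"
    using Suc.prems(2,3) by blast
  have "\<exists>y. for_loop R [Suc a..<b] z y \<and> P b y"
  proof (rule Suc.hyps(1)[OF _ _ z(2)])
    show "\<exists>y. R i x' y \<and> P (Suc i) y" if "Suc a \<le> i" "i < b" "P i x'" for i x'
      using Suc.prems(3)[OF _ that(2,3)] that(1) by simp
  qed (use Suc.hyps(2) \<open>a < b\<close> in auto)
  then show ?case using z(1) \<open>a < b\<close> by (auto simp: upt_conv_Cons)
qed

section \<open>Hall's theorem with capacities\<close>

text \<open>A set inside \<open>I\<close> or \<open>J\<close> lies inside the union, and one inside
  both lies inside the intersection. The union may contain further sets, hence only an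
  inequality.\<close>

lemma size_filter_subset_supermodular:
  "size (filter_mset (\<lambda>U. U \<subseteq> I) C) + size (filter_mset (\<lambda>U. U \<subseteq> J) C)
    \<le> size (filter_mset (\<lambda>U. U \<subseteq> I \<union> J) C) + size (filter_mset (\<lambda>U. U \<subseteq> I \<inter> J) C)"
  by (induction C) auto

text \<open>The sets \<open>J\<close> attaining equality in Hall's condition for \<open>C\<close> are closed under unions. If
  no element of an additional set \<open>U\<close> could be used for \<open>U\<close>, such sets would cover \<open>U\<close>, and
  their union would violate the condition for \<open>C\<close> extended by \<open>U\<close>.\<close>

lemma hall_capacitated:
  fixes C :: "'a set multiset" and n :: "'a \<Rightarrow> nat"
  assumes "finite V" and "\<And>U. U \<in># C \<Longrightarrow> U \<subseteq> V"
    and "\<And>J. J \<subseteq> V \<Longrightarrow> size (filter_mset (\<lambda>U. U \<subseteq> J) C) \<le> sum n J"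
  shows "\<exists>A. C = (\<Sum>i\<in>V. A i) \<and> (\<forall>i\<in>V. size (A i) \<le> n i \<and> (\<forall>U\<in>#A i. i \<in> U))"
  using assms(2,3)
proof (induction C arbitrary: n)
  case empty
  show ?case by (rule exI[of _ "\<lambda>_. {#}"]) simp
next
  case (add U C)
  let ?h = "\<lambda>J. size (filter_mset (\<lambda>U. U \<subseteq> J) C)"
  have UV: "U \<subseteq> V" using add.prems(1) by simp
  then have finU: "finite U" using assms(1) finite_subset by blast
  have hall: "?h J \<le> sum n J" if "J \<subseteq> V" for J
    using add.prems(2)[OF that] by (simp split: if_splits)
  have "\<exists>i\<in>U. \<forall>J\<subseteq>V. i \<in> J \<longrightarrow> ?h J < sum n J"
  proof (rule ccontr)
    assume "\<not> ?thesis"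
    then have "\<forall>i\<in>U. \<exists>J\<subseteq>V. i \<in> J \<and> ?h J = sum n J"
      using hall by (metis order.not_eq_order_implies_strict)
    then obtain J where J: "\<And>i. i \<in> U \<Longrightarrow> J i \<subseteq> V \<and> i \<in> J i \<and> ?h (J i) = sum n (J i)"
      by metis
    have "?h (\<Union>i\<in>Y. J i) = sum n (\<Union>i\<in>Y. J i)" if "finite Y" "Y \<subseteq> U" for Y
      using that
    proof (induction Y)
      case empty
      then show ?case using hall[of "{}"] by simp
    next
      case (insert i Y)
      let ?I = "J i" and ?K = "\<Union>i\<in>Y. J i"
      have sub: "?I \<subseteq> V" "?K \<subseteq> V" using J insert.prems by auto
      then have fin: "finite ?I" "finite ?K" using assms(1) finite_subset by blast+
      have "?h ?I = sum n ?I" "?h ?K = sum n ?K" using J insert by auto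
      moreover have "?h (?I \<inter> ?K) \<le> sum n (?I \<inter> ?K)" "?h (?I \<union> ?K) \<le> sum n (?I \<union> ?K)"
        using sub by (intro hall; blast)+
      moreover have "sum n (?I \<union> ?K) + sum n (?I \<inter> ?K) = sum n ?I + sum n ?K"
        using fin by (rule sum.union_inter)
      \<comment> \<open>\<open>?h\<close> is supermodular and \<open>sum n\<close> is modular, so
        equality for \<open>?I\<close> and \<open>?K\<close> leaves no slack for their union and
        intersection.\<close>
      ultimately show ?case
        using size_filter_subset_supermodular[of ?I C ?K] by simp
    qed
    from this[OF finU order.refl]
    have "?h (\<Union>i\<in>U. J i) = sum n (\<Union>i\<in>U. J i)" .
    moreover have "U \<subseteq> (\<Union>i\<in>U. J i)" "(\<Union>i\<in>U. J i) \<subseteq> V" using J by blast+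
    ultimately show False using add.prems(2)[of "\<Union>i\<in>U. J i"] by simp
  qed
  then obtain i where i: "i \<in> U" "\<And>J. J \<subseteq> V \<Longrightarrow> i \<in> J \<Longrightarrow> ?h J < sum n J" by blast
  \<comment> \<open>Since \<open>i\<close> lies in no set attaining equality, it can take
    \<open>U\<close> and give up one unit of capacity without breaking Hall's condition. The strict
    inequality at \<open>{i}\<close> shows that this unit exists.\<close>
  have "0 < n i" using i(2)[of "{i}"] i(1) UV by auto
  let ?n = "n(i := n i - 1)"
  have "?h J \<le> sum ?n J" if "J \<subseteq> V" for J
  proof (cases "i \<in> J")
    case True
    have "finite J" using that assms(1) finite_subset by blast
    then have "sum n J = n i + sum n (J - {i})" "sum ?n J = n i - 1 + sum n (J - {i})"
      using True by (auto simp: sum.remove intro!: sum.cong)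
    then show ?thesis using i(2)[OF that True] by linarith
  next
    case False
    then have "sum ?n J = sum n J" by (intro sum.cong) auto
    then show ?thesis using hall[OF that] by simp
  qed
  then obtain A where A: "C = (\<Sum>i\<in>V. A i)" "\<forall>j\<in>V. size (A j) \<le> ?n j \<and> (\<forall>U\<in>#A j. j \<in> U)"
    using add.IH[of ?n] add.prems(1) by auto
  have iV: "i \<in> V" using i(1) UV by auto
  have "add_mset U C = (\<Sum>j\<in>V. (A(i := add_mset U (A i))) j)"
  proof -
    have "(\<Sum>j\<in>V. (A(i := add_mset U (A i))) j) = add_mset U (A i) + (\<Sum>j\<in>V - {i}. A j)"
      using iV assms(1) by (auto simp: sum.remove intro!: sum.cong)
    also have "\<dots> = add_mset U (\<Sum>j\<in>V. A j)"
      using iV assms(1) by (simp add: sum.remove)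
    finally show ?thesis using A(1) by simp
  qed
  moreover have "\<forall>j\<in>V. size ((A(i := add_mset U (A i))) j) \<le> n j \<and>
      (\<forall>U\<in>#(A(i := add_mset U (A i))) j. j \<in> U)"
    using A(2) i(1) \<open>0 < n i\<close> iV by (auto split: if_splits)
  ultimately show ?case by blast
qed

lemma filter_repeat_mset: "filter_mset P (repeat_mset m A) = repeat_mset m (filter_mset P A)"
  by (induction m) auto

lemma in_repeat_mset: "x \<in># repeat_mset m A \<Longrightarrow> x \<in># A"
  by (induction m) auto

text \<open>The \<open>k\<close>-subsets inside \<open>J\<close> are the \<open>k\<close>-subsets of
  \<open>J\<close>, which gives the left side of Hall's condition. As the capacities add up to the
  number of sets to be distributed, none of them can remain unfilled.\<close>

lemma assignment_exists:
  fixes n :: "nat \<Rightarrow> nat"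
  assumes "\<And>J. J \<subseteq> {1..N} \<Longrightarrow> m * (card J choose k) \<le> sum n J"
    and "m * (N choose k) = sum n {1..N}"
  shows "\<exists>A. repeat_mset m (mset_set {U. U \<subseteq> {1..N} \<and> card U = k}) = (\<Sum>i\<in>{1..N}. A i) \<and>
    (\<forall>i\<in>{1..N}. size (A i) = n i \<and> (\<forall>U\<in>#A i. i \<in> U))"
proof -
  let ?C = "repeat_mset m (mset_set {U. U \<subseteq> {1..N} \<and> card U = k})"
  have fin: "finite {U. U \<subseteq> {1..N} \<and> card U = k}" by simp
  have size: "size (filter_mset (\<lambda>U. U \<subseteq> J) ?C) = m * (card J choose k)" if "J \<subseteq> {1..N}" for J
  proof -
    have "filter_mset (\<lambda>U. U \<subseteq> J) ?C = repeat_mset m (mset_set {U. U \<subseteq> J \<and> card U = k})"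
    proof -
      have "{x. x \<subseteq> {1..N} \<and> card x = k \<and> x \<subseteq> J} = {U. U \<subseteq> J \<and> card U = k}" using that by auto
      then show ?thesis by (simp add: filter_repeat_mset conj_assoc)
    qed
    then show ?thesis using that finite_subset[OF that] by (simp add: n_subsets)
  qed
  have "\<exists>A. ?C = (\<Sum>i\<in>{1..N}. A i) \<and> (\<forall>i\<in>{1..N}. size (A i) \<le> n i \<and> (\<forall>U\<in>#A i. i \<in> U))"
  proof (rule hall_capacitated)
    show "U \<subseteq> {1..N}" if "U \<in># ?C" for U
      using in_repeat_mset[OF that] fin by auto
  qed (use size assms(1) in auto)
  then obtain A where A: "?C = (\<Sum>i\<in>{1..N}. A i)"
    "\<And>i. i \<in> {1..N} \<Longrightarrow> size (A i) \<le> n i \<and> (\<forall>U\<in>#A i. i \<in> U)"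
    by metis
  have "(\<Sum>i\<in>{1..N}. size (A i)) = size ?C" by (simp only: A(1) size_multiset_sum)
  also have "\<dots> = sum n {1..N}" using assms(2) by (simp add: n_subsets)
  finally have "\<forall>i\<in>{1..N}. size (A i) = n i"
    using A(2) sum_mono_inv[of "\<lambda>i. size (A i)" "{1..N}" n] by blast
  then show ?thesis using A by blast
qed

section \<open>Symbols revealed by a run\<close>

text \<open>A query of this kind can be solved for the symbol given by the pair as soon as all
  positions up to the counters \<open>T\<close> are known. The pair later serves as a label of the
  query.\<close>

definition fresh_query :: "nat \<Rightarrow> nat \<Rightarrow> (nat \<Rightarrow> nat) \<Rightarrow> nat \<times> nat \<Rightarrow> query \<Rightarrow> bool" where
  "fresh_query N k T = (\<lambda>(v, \<tau>) q. dom q \<subseteq> {1..N} \<and> card (dom q) = k \<and>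
     q v = Some \<tau> \<and> T v < \<tau> \<and> old_on (dom q - {v}) T q)"

lemma fresh_query_unique:
  assumes "fresh_query N k T (v, \<tau>) q" and "q u = Some \<sigma>" and "T u < \<sigma>"
  shows "(u, \<sigma>) = (v, \<tau>)"
proof (cases "u = v")
  case True
  then show ?thesis using assms by (simp add: fresh_query_def)
next
  case False
  then have "u \<in> dom q - {v}" using assms(2) by auto
  then obtain \<rho> where "\<rho> \<in> {1..T u}" "q u = Some \<rho>"
    using assms(1) unfolding fresh_query_def old_on_def by blast
  then show ?thesis using assms(2,3) by simp
qed

text \<open>One query cannot serve two positions, so a family of fresh queries indexed by positions
  is injective. This turns counting queries into counting positions.\<close>

lemma fresh_query_inj:
  assumes "fresh_query N k T e q" and "fresh_query N k T e' q"
  shows "e = e'"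
proof -
  obtain v \<tau> u \<sigma> where e: "e = (v, \<tau>)" "e' = (u, \<sigma>)" by (meson surj_pair)
  then have "q u = Some \<sigma>" "T u < \<sigma>" using assms(2) by (simp_all add: fresh_query_def)
  from fresh_query_unique[OF assms(1)[unfolded e(1)] this] show ?thesis using e by simp
qed

abbreviation new_positions :: "nat \<Rightarrow> (nat \<Rightarrow> nat) \<Rightarrow> (nat \<Rightarrow> nat) \<Rightarrow> (nat \<times> nat) set" where
  "new_positions N t t' \<equiv> SIGMA i:{1..N}. {t i<..t' i}"

lemma new_positions_Suc:
  assumes "i \<in> {1..N}" and "t0 i \<le> t i"
  shows "new_positions N t0 (t(i := t i + 1)) = insert (i, t i + 1) (new_positions N t0 t)"
  using assms by (auto split: if_splits)

text \<open>Although an exchange step rewrites an earlier query, the queries produced by one database in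
  one round always correspond bijectively to the positions revealed meanwhile: the query \<open>f (i, \<tau>)\<close>
  contains position \<open>\<tau>\<close> of file \<open>i\<close> and otherwise only positions known before the round.\<close>

definition db_inv :: "nat \<Rightarrow> nat \<Rightarrow> nat \<Rightarrow> (nat \<Rightarrow> nat) \<Rightarrow> (nat \<Rightarrow> query set) \<Rightarrow> (nat \<Rightarrow> nat)
    \<Rightarrow> state \<Rightarrow> bool" where
  "db_inv N k s T Q0 t0 = (\<lambda>(Q, t, C, D).
     (\<forall>U\<in>#C. U \<subseteq> {1..N} \<and> card U = k) \<and> t0 \<le> t \<and> Q = Q0(s := Q0 s \<union> D) \<and>
     (\<exists>f. D = f ` new_positions N t0 t \<and> (\<forall>e\<in>new_positions N t0 t. fresh_query N k T e (f e))))"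

text \<open>A direct step labels its query with the new position; an exchange step hands labels
  over. Queries of \<open>Q0 s\<close> have sizes other than \<open>k\<close>, so the removal of
  \<open>q'\<close> only affects queries of the current round.\<close>

lemma db_inv_step:
  assumes "query_step s T i st st'" and "db_inv N k s T Q0 t0 st"
    and "i \<in> {1..N}" and "T \<le> t0" and "\<forall>q\<in>Q0 s. card (dom q) \<noteq> k"
  shows "db_inv N k s T Q0 t0 st' \<and> fst (snd st') = (fst (snd st))(i := fst (snd st) i + 1)"
  using assms(1)
proof cases
  case (direct U C q t Q D)
  obtain f where f: "D = f ` new_positions N t0 t"
      "\<And>e. e \<in> new_positions N t0 t \<Longrightarrow> fresh_query N k T e (f e)"
    and inv: "\<And>U. U \<in># C \<Longrightarrow> U \<subseteq> {1..N} \<and> card U = k" "t0 \<le> t" "Q = Q0(s := Q0 s \<union> D)"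
    using assms(2) unfolding direct(1) db_inv_def by auto
  have "T i < t i + 1"
    using le_funD[OF assms(4), of i] le_funD[OF inv(2), of i] by simp
  then have fresh: "fresh_query N k T (i, t i + 1) q"
    using inv(1)[OF direct(3)] direct by (auto simp: fresh_query_def)
  let ?f = "f((i, t i + 1) := q)"
  have pos: "new_positions N t0 (t(i := t i + 1)) = insert (i, t i + 1) (new_positions N t0 t)"
    using assms(3) inv(2) by (intro new_positions_Suc) (auto simp: le_fun_def)
  have "insert q D = ?f ` new_positions N t0 (t(i := t i + 1))"
    unfolding pos f(1) by (auto simp: image_iff)
  moreover have "\<forall>e\<in>new_positions N t0 (t(i := t i + 1)). fresh_query N k T e (?f e)"
    unfolding pos using f(2) fresh by auto
  moreover have "t0 \<le> t(i := t i + 1)"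
    using inv(2) by (auto simp: le_fun_def le_SucI)
  moreover have "\<forall>U\<in>#C - {#U#}. U \<subseteq> {1..N} \<and> card U = k"
    using inv(1) by (meson in_diffD)
  ultimately show ?thesis
    unfolding direct(1,2) db_inv_def prod.case fst_conv snd_conv
    using inv(3) by (intro conjI exI[of _ ?f]) (auto simp: fun_eq_iff)
next
  case (exchange C U q' D v \<tau>\<^sub>v q \<tau> q'' t Q)
  obtain f where f: "D = f ` new_positions N t0 t"
      "\<And>e. e \<in> new_positions N t0 t \<Longrightarrow> fresh_query N k T e (f e)"
    and inv: "\<And>U. U \<in># C \<Longrightarrow> U \<subseteq> {1..N} \<and> card U = k" "t0 \<le> t" "Q = Q0(s := Q0 s \<union> D)"
    using assms(2) unfolding exchange(1) db_inv_def by auto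
  \<comment> \<open>No set left in \<open>C\<close> contains \<open>i\<close>, whereas
    \<open>U\<close> contains \<open>v\<close>. Hence the two updates that form \<open>q''\<close>
    do not collide.\<close>
  have vi: "v \<noteq> i" using exchange(3-6) by auto
  obtain e where e: "e \<in> new_positions N t0 t" "q' = f e" using f(1) exchange(5) by auto
  \<comment> \<open>The symbol of \<open>v\<close> in \<open>q'\<close> lies beyond
    \<open>T v\<close>. A fresh query has only one such symbol, so this is the label of
    \<open>q'\<close>.\<close>
  have "e = (v, \<tau>\<^sub>v)"
    using f(2)[OF e(1)] exchange(8,9) fresh_query_unique[of N k T "fst e" "snd e" q' v \<tau>\<^sub>v] e(2) by simp
  then have e: "(v, \<tau>\<^sub>v) \<in> new_positions N t0 t" "q' = f (v, \<tau>\<^sub>v)" using e by simp_all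
  have fresh': "fresh_query N k T (v, \<tau>\<^sub>v) q'" using f(2) e by blast
  have Ti: "T i < t i + 1"
    using le_funD[OF assms(4), of i] le_funD[OF inv(2), of i] by simp
  have fresh: "fresh_query N k T (v, \<tau>\<^sub>v) q"
    using inv(1)[OF exchange(4)] exchange(9-12) by (auto simp: fresh_query_def)
  have dom: "dom q'' = dom q'" using exchange(6,7,14) by auto
  have "old_on (dom q'' - {i}) T q''"
    unfolding old_on_def
  proof
    fix u
    assume u: "u \<in> dom q'' - {i}"
    show "\<exists>\<sigma>\<in>{1..T u}. q'' u = Some \<sigma>"
    proof (cases "u = v")
      case True
      then show ?thesis using exchange(13,14) by auto
    next
      case False
      then have "q'' u = q' u" "u \<in> dom q' - {v}" using u dom exchange(14) by auto
      then show ?thesis using fresh' by (auto simp: fresh_query_def old_on_def)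
    qed
  qed
  then have fresh'': "fresh_query N k T (i, t i + 1) q''"
    using fresh' dom vi Ti exchange(14) by (auto simp: fresh_query_def)
  \<comment> \<open>\<open>q\<close> takes over the position \<open>(v, \<tau>\<^sub>v)\<close> from
    \<open>q'\<close>, and the rewritten query \<open>q''\<close> receives the new position of
    \<open>i\<close>.\<close>
  let ?f = "f((v, \<tau>\<^sub>v) := q, (i, t i + 1) := q'')"
  have pos: "new_positions N t0 (t(i := t i + 1)) = insert (i, t i + 1) (new_positions N t0 t)"
    using assms(3) inv(2) by (intro new_positions_Suc) (auto simp: le_fun_def)
  have old: "(i, t i + 1) \<notin> new_positions N t0 t" by simp
  \<comment> \<open>By injectivity \<open>q'\<close> belongs to no other position, so deleting it
    from \<open>D\<close> removes the image of exactly one label.\<close>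
  have "inj_on f (new_positions N t0 t)"
    by (rule inj_onI) (metis f(2) fresh_query_inj)
  then have "D - {q'} = f ` (new_positions N t0 t - {(v, \<tau>\<^sub>v)})"
    unfolding f(1) e(2) using e(1) by (subst inj_on_image_set_diff) auto
  moreover have "?f ` new_positions N t0 t = insert q (f ` (new_positions N t0 t - {(v, \<tau>\<^sub>v)}))"
  proof -
    have fv: "?f (v, \<tau>\<^sub>v) = q" using vi by simp
    have "?f ` new_positions N t0 t
        = ?f ` insert (v, \<tau>\<^sub>v) (new_positions N t0 t - {(v, \<tau>\<^sub>v)})"
      using e(1) by (simp only: insert_Diff)
    also have "\<dots> = insert q (?f ` (new_positions N t0 t - {(v, \<tau>\<^sub>v)}))"
      by (simp only: image_insert fv)
    also have "?f ` (new_positions N t0 t - {(v, \<tau>\<^sub>v)})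
        = f ` (new_positions N t0 t - {(v, \<tau>\<^sub>v)})"
      using old by (intro image_cong refl) (metis DiffE fun_upd_other insertCI)
    finally show ?thesis .
  qed
  ultimately have "insert q (insert q'' (D - {q'})) = ?f ` new_positions N t0 (t(i := t i + 1))"
    unfolding pos by (simp only: image_insert fun_upd_same insert_commute)
  moreover have "\<forall>e\<in>new_positions N t0 (t(i := t i + 1)). fresh_query N k T e (?f e)"
    unfolding pos using f(2) fresh fresh'' vi by auto
  moreover have "t0 \<le> t(i := t i + 1)"
    using inv(2) by (auto simp: le_fun_def le_SucI)
  moreover have "\<forall>U\<in>#C - {#U#}. U \<subseteq> {1..N} \<and> card U = k"
    using inv(1) by (meson in_diffD)
  moreover have "q' \<notin> Q0 s" using assms(5) fresh' by (auto simp: fresh_query_def)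
  then have "insert q (insert q'' (Q s - {q'})) = Q0 s \<union> insert q (insert q'' (D - {q'}))"
    using inv(3) by auto
  ultimately show ?thesis
    unfolding exchange(1,2) db_inv_def prod.case fst_conv snd_conv
    using inv(3) by (intro conjI exI[of _ ?f]) (auto simp: fun_eq_iff)
qed

lemma db_inv_steps:
  assumes "(query_step s T i ^^ m) st st'" and "db_inv N k s T Q0 t0 st"
    and "i \<in> {1..N}" and "T \<le> t0" and "\<forall>q\<in>Q0 s. card (dom q) \<noteq> k"
  shows "db_inv N k s T Q0 t0 st' \<and> fst (snd st') = (fst (snd st))(i := fst (snd st) i + m)"
  using assms(1)
proof (induction m arbitrary: st')
  case 0
  then show ?case using assms(2) by simp
next
  case (Suc m)
  then obtain st1 where st1: "(query_step s T i ^^ m) st st1" "query_step s T i st1 st'" by auto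
  have IH: "db_inv N k s T Q0 t0 st1" "fst (snd st1) = (fst (snd st))(i := fst (snd st) i + m)"
    using Suc.IH[OF st1(1)] by blast+
  show ?case
    using db_inv_step[OF st1(2) IH(1) assms(3-5)] unfolding IH(2) by (simp add: add.assoc)
qed

text \<open>\<open>T\<close> holds the counters at the start of the round and \<open>t\<close> those
  on arrival at database \<open>s\<close>. They can differ because databases served earlier in the
  same round have advanced them.\<close>

lemma db_round_effect:
  assumes "db_round N m n k T s (Q, t) (Q', t')" and "T \<le> t"
    and "\<forall>q\<in>Q s. card (dom q) \<noteq> k"
  shows "\<exists>f. Q' = Q(s := Q s \<union> f ` new_positions N t t') \<and>
      (\<forall>e\<in>new_positions N t t'. fresh_query N k T e (f e))"
    and "\<And>i. i \<in> {1..N} \<Longrightarrow> t' i = t i + n s i k"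
    and "t \<le> t'"
proof -
  let ?C = "repeat_mset (m s k) (mset_set {U. U \<subseteq> {1..N} \<and> card U = k})"
  obtain C' D' where loop: "for_loop (\<lambda>i. query_step s T i ^^ n s i k) [1..<N + 1]
      (Q, t, ?C, {}) (Q', t', C', D')"
    using assms(1) unfolding db_round_def by auto
  let ?P = "\<lambda>i st. db_inv N k s T Q t st \<and>
      (\<forall>j. fst (snd st) j = (if 1 \<le> j \<and> j < i then t j + n s j k else t j))"
  have "?P (N + 1) (Q', t', C', D')"
  proof (rule for_loop_invariant[OF loop])
    have C: "\<forall>U\<in>#?C. U \<subseteq> {1..N} \<and> card U = k"
    proof
      fix U
      assume "U \<in># ?C"
      from in_repeat_mset[OF this] show "U \<subseteq> {1..N} \<and> card U = k" by simp
    qed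
    have "db_inv N k s T Q t (Q, t, ?C, {})"
      unfolding db_inv_def prod.case by (intro conjI C) simp_all
    then show "?P 1 (Q, t, ?C, {})" by simp
  next
    fix i st st'
    assume i: "1 \<le> i" "i < N + 1" "(query_step s T i ^^ n s i k) st st'" "?P i st"
    have "i \<in> {1..N}" using i(1,2) by simp
    then have step: "db_inv N k s T Q t st'"
        "fst (snd st') = (fst (snd st))(i := fst (snd st) i + n s i k)"
      using db_inv_steps[OF i(3) conjunct1[OF i(4)] _ assms(2,3)] by simp_all
    then show "?P (Suc i) st'" using i(1) conjunct2[OF i(4)] by simp
  qed simp
  then have inv: "db_inv N k s T Q t (Q', t', C', D')" and t': "\<And>i. i \<in> {1..N} \<Longrightarrow> t' i = t i + n s i k"
    by simp_all
  from inv obtain f where f: "D' = f ` new_positions N t t'"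
      "\<forall>e\<in>new_positions N t t'. fresh_query N k T e (f e)"
    and Q': "t \<le> t'" "Q' = Q(s := Q s \<union> D')"
    unfolding db_inv_def prod.case by (elim conjE exE) rule
  show "\<exists>f. Q' = Q(s := Q s \<union> f ` new_positions N t t') \<and>
      (\<forall>e\<in>new_positions N t t'. fresh_query N k T e (f e))"
    using f(2) unfolding Q'(2) f(1) by (intro exI[of _ f] conjI refl)
  show "t' i = t i + n s i k" if "i \<in> {1..N}" for i using that by (rule t')
  show "t \<le> t'" by (rule Q'(1))
qed

section \<open>Decoding positions round by round\<close>

abbreviation positions :: "nat \<Rightarrow> (nat \<Rightarrow> nat) \<Rightarrow> (nat \<times> nat) set" where
  "positions N t \<equiv> SIGMA i:{1..N}. {1..t i}"

text \<open>Closure of a set of known positions under solving a query for its only unknown symbol.\<close>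

definition peel_closed :: "nat \<Rightarrow> (nat \<Rightarrow> query set) \<Rightarrow> (nat \<times> nat) set \<Rightarrow> bool" where
  "peel_closed S Q X \<longleftrightarrow>
     (\<forall>s\<in>{1..S}. \<forall>q\<in>Q s. \<forall>i\<in>dom q. (\<forall>u\<in>dom q - {i}. (u, the (q u)) \<in> X) \<longrightarrow> (i, the (q i)) \<in> X)"

lemma peel_closedD:
  assumes "peel_closed S Q X" and "s \<in> {1..S}" and "q \<in> Q s" and "q i = Some \<tau>"
    and "\<And>u. u \<in> dom q - {i} \<Longrightarrow> (u, the (q u)) \<in> X"
  shows "(i, \<tau>) \<in> X"
proof -
  have "i \<in> dom q" using assms(4) by (rule domI)
  then have "(i, the (q i)) \<in> X"
    by (rule assms(1)[unfolded peel_closed_def, rule_format, OF assms(2,3)]) (rule assms(5))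
  then show ?thesis using assms(4) by simp
qed

lemma peel_closed_mono:
  assumes "peel_closed S Q' X" and "\<And>s. Q s \<subseteq> Q' s"
  shows "peel_closed S Q X"
  using assms unfolding peel_closed_def by (meson subsetD)

text \<open>The sizes in \<open>I\<close> tell the rounds apart: queries of round \<open>k\<close>
  have exactly \<open>k\<close> symbols and so differ from all earlier ones.\<close>

definition queries_within :: "nat \<Rightarrow> nat set \<Rightarrow> query set \<Rightarrow> bool" where
  "queries_within N I Y \<longleftrightarrow> finite Y \<and> (\<forall>q\<in>Y. dom q \<subseteq> {1..N} \<and> card (dom q) \<in> I)"

lemma queries_within_mono: "queries_within N I Y \<Longrightarrow> I \<subseteq> J \<Longrightarrow> queries_within N J Y"
  unfolding queries_within_def by blast

lemma queries_within_Un: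
  assumes "queries_within N I Y" and "queries_within N I Z"
  shows "queries_within N I (Y \<union> Z)"
  using assms unfolding queries_within_def by blast

lemma fresh_query_peel:
  assumes "fresh_query N k T (v, \<tau>) q" and "q \<in> Q s" and "s \<in> {1..S}"
    and "peel_closed S Q X" and "positions N T \<subseteq> X"
  shows "(v, \<tau>) \<in> X"
proof -
  have q: "dom q \<subseteq> {1..N}" "q v = Some \<tau>" "old_on (dom q - {v}) T q"
    using assms(1) by (auto simp: fresh_query_def)
  show ?thesis
  proof (rule peel_closedD[of S Q X s q v \<tau>, OF assms(4,3,2) q(2)])
    fix u
    assume u: "u \<in> dom q - {v}"
    then obtain \<sigma> where "\<sigma> \<in> {1..T u}" "q u = Some \<sigma>" using q(3) unfolding old_on_def by blast
    then show "(u, the (q u)) \<in> X" using u subsetD[OF q(1), of u] assms(5) by auto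
  qed
qed

text \<open>Old symbols are always measured against the counters at the start of the round. Hence
  the databases decouple: the new positions of each are solved from \<open>positions N t\<close>
  alone.\<close>

lemma k_round_effect:
  assumes "k_round S N m n k (Q, t) (Q', t')" and "1 \<le> k"
    and "\<And>s. queries_within N {1..<k} (Q s)"
  shows "\<And>s. queries_within N {1..<Suc k} (Q' s)"
    and "\<And>s. Q s \<subseteq> Q' s"
    and "\<And>i. i \<in> {1..N} \<Longrightarrow> t' i = t i + (\<Sum>s=1..S. n s i k)"
    and "\<And>s. s \<in> {1..S} \<Longrightarrow> card (Q' s) = card (Q s) + (\<Sum>i=1..N. n s i k)"
    and "\<And>X. peel_closed S Q' X \<Longrightarrow> positions N t \<subseteq> X \<Longrightarrow> positions N t' \<subseteq> X"
proof -
  have loop: "for_loop (db_round N m n k t) [1..<S + 1] (Q, t) (Q', t')"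
    using assms(1) by (simp add: k_round_def)
  \<comment> \<open>Databases from \<open>j\<close> on still hold only queries of earlier rounds,
    none of size \<open>k\<close>. This is what \<open>db_round_effect\<close> demands of
    \<open>Q1 j\<close>.\<close>
  let ?P = "\<lambda>j (Q1, t1). (\<forall>s. queries_within N {1..<Suc k} (Q1 s)) \<and> (\<forall>s\<ge>j. Q1 s = Q s) \<and>
      (\<forall>s. Q s \<subseteq> Q1 s) \<and> t \<le> t1 \<and> (\<forall>i\<in>{1..N}. t1 i = t i + (\<Sum>s=1..<j. n s i k)) \<and>
      (\<forall>s\<in>{1..<j}. card (Q1 s) = card (Q s) + (\<Sum>i=1..N. n s i k)) \<and>
      (\<forall>X. peel_closed S Q1 X \<longrightarrow> positions N t \<subseteq> X \<longrightarrow> positions N t1 \<subseteq> X)"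
  have "?P (S + 1) (Q', t')"
  proof (rule for_loop_invariant[OF loop])
    show "?P 1 (Q, t)"
      using queries_within_mono[OF assms(3), of "{1..<Suc k}"] by auto
  next
    fix j st st'
    assume j: "1 \<le> j" "j < S + 1" and step: "db_round N m n k t j st st'" and P0: "?P j st"
    obtain Q1 t1 Q2 t2 where st: "st = (Q1, t1)" "st' = (Q2, t2)" by (meson surj_pair)
    note P0' = P0[unfolded st prod.case]
    note P = P0'[THEN conjunct1, rule_format]
      P0'[THEN conjunct2, THEN conjunct1, rule_format]
      P0'[THEN conjunct2, THEN conjunct2, THEN conjunct1, rule_format]
      P0'[THEN conjunct2, THEN conjunct2, THEN conjunct2, THEN conjunct1, rule_format]
      P0'[THEN conjunct2, THEN conjunct2, THEN conjunct2, THEN conjunct2, THEN conjunct1, rule_format]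
      P0'[THEN conjunct2, THEN conjunct2, THEN conjunct2, THEN conjunct2, THEN conjunct2, THEN conjunct1, rule_format]
      P0'[THEN conjunct2, THEN conjunct2, THEN conjunct2, THEN conjunct2, THEN conjunct2, THEN conjunct2, rule_format]
    have Qj: "queries_within N {1..<k} (Q1 j)" using assms(3) P(2) by simp
    then have Qjk: "\<forall>q\<in>Q1 j. card (dom q) \<noteq> k"
      unfolding queries_within_def by (metis atLeastLessThan_iff less_irrefl)
    note eff = db_round_effect[OF step[unfolded st] P(4) Qjk]
    obtain f where f: "Q2 = Q1(j := Q1 j \<union> f ` new_positions N t1 t2)"
        "\<forall>e\<in>new_positions N t1 t2. fresh_query N k t e (f e)"
      using eff(1) by (elim exE conjE)
    note f = f(1) f(2)[rule_format] eff(2,3)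
    have inj: "inj_on f (new_positions N t1 t2)"
      by (rule inj_onI) (metis f(2) fresh_query_inj)
    have fin: "finite (new_positions N t1 t2)" by simp
    have within: "queries_within N {k} (f ` new_positions N t1 t2)"
      unfolding queries_within_def
    proof (intro conjI ballI)
      fix q
      assume "q \<in> f ` new_positions N t1 t2"
      then obtain e where "e \<in> new_positions N t1 t2" "q = f e" by blast
      then show "dom q \<subseteq> {1..N}" "card (dom q) \<in> {k}"
        using f(2)[of e] by (auto simp: fresh_query_def)
    qed (use fin in blast)
    have disj: "Q1 j \<inter> f ` new_positions N t1 t2 = {}"
      using Qjk within unfolding queries_within_def by blast
    have mono: "Q1 s \<subseteq> Q2 s" for s unfolding f(1) by simp
    have "queries_within N {1..<Suc k} (f ` new_positions N t1 t2)"
      using within by (rule queries_within_mono) (use assms(2) in auto)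
    then have "queries_within N {1..<Suc k} (Q2 s)" for s
      using P(1) unfolding f(1) by (simp add: queries_within_Un)
    moreover have "Q2 s = Q s" if "s \<ge> Suc j" for s using that P(2) f(1) by simp
    moreover have "Q s \<subseteq> Q2 s" for s using P(3) mono by blast
    moreover have "t \<le> t2" using P(4) f(4) by simp
    moreover have "t2 i = t i + (\<Sum>s=1..<Suc j. n s i k)" if "i \<in> {1..N}" for i
      using P(5) f(3) that j by simp
    moreover have "card (Q2 s) = card (Q s) + (\<Sum>i=1..N. n s i k)" if "s \<in> {1..<Suc j}" for s
    proof (cases "s = j")
      case True
      have "card (Q2 j) = card (Q1 j) + card (f ` new_positions N t1 t2)"
        using disj fin Qj unfolding f(1) queries_within_def by (simp add: card_Un_disjoint)
      also have "card (f ` new_positions N t1 t2) = (\<Sum>i=1..N. t2 i - t1 i)"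
        using inj by (simp add: card_image)
      also have "\<dots> = (\<Sum>i=1..N. n j i k)" by (intro sum.cong) (simp_all add: f(3))
      finally show ?thesis using True P(2)[of j] by simp
    next
      case False
      then show ?thesis using P(6)[of s] that f(1) by simp
    qed
    moreover have "positions N t2 \<subseteq> X" if X: "peel_closed S Q2 X" "positions N t \<subseteq> X" for X
    proof
      fix e
      assume e: "e \<in> positions N t2"
      \<comment> \<open>Positions revealed by earlier databases come from the invariant; a new one
        is the only unknown of its query \<open>f e\<close>.\<close>
      show "e \<in> X"
      proof (cases "e \<in> positions N t1")
        case True
        then show ?thesis using P(7)[OF peel_closed_mono[OF X(1) mono] X(2)] by blast
      next
        case False
        then have "e \<in> new_positions N t1 t2" using e by auto
        then have "fresh_query N k t (fst e, snd e) (f e)" "f e \<in> Q2 j"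
          using f(1,2) by auto
        from fresh_query_peel[OF this _ X] show ?thesis using j by simp
      qed
    qed
    ultimately show "?P (Suc j) st'"
      unfolding st prod.case by (intro conjI allI impI ballI)
  qed simp
  note res = this[unfolded prod.case]
  note res' = res[THEN conjunct1, rule_format]
      res[THEN conjunct2, THEN conjunct1, rule_format]
      res[THEN conjunct2, THEN conjunct2, THEN conjunct1, rule_format]
      res[THEN conjunct2, THEN conjunct2, THEN conjunct2, THEN conjunct1, rule_format]
      res[THEN conjunct2, THEN conjunct2, THEN conjunct2, THEN conjunct2, THEN conjunct1, rule_format]
      res[THEN conjunct2, THEN conjunct2, THEN conjunct2, THEN conjunct2, THEN conjunct2, THEN conjunct1, rule_format]
      res[THEN conjunct2, THEN conjunct2, THEN conjunct2, THEN conjunct2, THEN conjunct2, THEN conjunct2, rule_format]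
  show "queries_within N {1..<Suc k} (Q' s)" for s
    by (rule res'(1))
  show "Q s \<subseteq> Q' s" for s
    by (rule res'(3))
  show "t' i = t i + (\<Sum>s=1..S. n s i k)" if "i \<in> {1..N}" for i
    using res'(5)[OF that] by (simp add: atLeastLessThanSuc_atLeastAtMost)
  show "card (Q' s) = card (Q s) + (\<Sum>i=1..N. n s i k)" if "s \<in> {1..S}" for s
    using that by (intro res'(6)) simp
  show "positions N t' \<subseteq> X" if "peel_closed S Q' X" "positions N t \<subseteq> X" for X
    using that by (rule res'(7))
qed

text \<open>The hypothesis on \<open>n\<close> at \<open>k = 1\<close> lets the initial state count as round 1.\<close>

lemma query_procedure_effect:
  assumes "query_procedure S N m n Q" and "S \<ge> 1" and "N \<ge> 1"
    and "\<forall>s\<in>{1..S}. \<forall>i\<in>{1..N}. n s i 1 = (if s = 1 then 1 else 0)"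
  shows "\<And>s. queries_within N {1..N} (Q s)"
    and "\<And>s. s \<in> {1..S} \<Longrightarrow> card (Q s) = (\<Sum>k=1..N. \<Sum>i=1..N. n s i k)"
    and "\<And>X. peel_closed S Q X \<Longrightarrow> positions N (\<lambda>i. \<Sum>k=1..N. \<Sum>s=1..S. n s i k) \<subseteq> X"
proof -
  let ?Q0 = "\<lambda>s. if s = 1 then {[i \<mapsto> 1] |i. i \<in> {1..N}} else {} :: query set"
  obtain t where loop: "for_loop (k_round S N m n) [2..<N + 1] (?Q0, \<lambda>i. 1) (Q, t)"
    using assms(1) unfolding query_procedure_def by blast
  let ?P = "\<lambda>k (Q, t). (\<forall>s. queries_within N {1..<k} (Q s)) \<and>
      (\<forall>s\<in>{1..S}. card (Q s) = (\<Sum>k=1..<k. \<Sum>i=1..N. n s i k)) \<and>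
      (\<forall>i\<in>{1..N}. t i = (\<Sum>k=1..<k. \<Sum>s=1..S. n s i k)) \<and>
      (\<forall>X. peel_closed S Q X \<longrightarrow> positions N t \<subseteq> X)"
  have "?P (N + 1) (Q, t)"
  proof (rule for_loop_invariant[OF loop])
    have Q0: "{[i \<mapsto> 1] |i. i \<in> {1..N}} = (\<lambda>i. [i \<mapsto> 1 :: nat]) ` {1..N}" by auto
    have "inj_on (\<lambda>i. [i \<mapsto> 1 :: nat]) {1..N}"
      by (rule inj_onI) (metis dom_eq_singleton_conv dom_fun_upd singleton_inject dom_empty option.distinct(1))
    then have card: "card {[i \<mapsto> 1 :: nat] |i. i \<in> {1..N}} = N"
      unfolding Q0 by (simp add: card_image)
    have "queries_within N {1..<2} (?Q0 s)" for s
      unfolding queries_within_def Q0 by (auto simp: dom_def split: if_splits)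
    moreover have "card (?Q0 s) = (\<Sum>k=1..<2. \<Sum>i=1..N. n s i k)" if "s \<in> {1..S}" for s
    proof -
      have "(\<Sum>k=1..<2. \<Sum>i=1..N. n s i k) = (\<Sum>i=1..N. n s i 1)"
        by (simp add: numeral_2_eq_2)
      also have "\<dots> = (\<Sum>i=1..N. if s = 1 then 1 else 0)"
        using that assms(4) by (intro sum.cong refl) blast
      finally show ?thesis using card by simp
    qed
    moreover have "1 = (\<Sum>k=1..<2. \<Sum>s=1..S. n s i k)" if "i \<in> {1..N}" for i
    proof -
      have "(\<Sum>k=1..<2. \<Sum>s=1..S. n s i k) = (\<Sum>s=1..S. n s i 1)"
        by (simp add: numeral_2_eq_2)
      also have "\<dots> = (\<Sum>s=1..S. if s = 1 then 1 else 0)"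
        using that assms(4) by (intro sum.cong refl) blast
      finally show ?thesis using assms(2) by simp
    qed
    \<comment> \<open>A singleton query has no other symbols that must be known first, so it reveals
      its own.\<close>
    moreover have "positions N (\<lambda>i. 1) \<subseteq> X" if "peel_closed S ?Q0 X" for X
    proof
      fix e
      assume "e \<in> positions N (\<lambda>i. 1)"
      then obtain i where i: "i \<in> {1..N}" "e = (i, 1)" by auto
      have "[i \<mapsto> 1] \<in> ?Q0 1" "1 \<in> {1..S}" using i(1) assms(2) by auto
      moreover have "i \<in> dom [i \<mapsto> 1 :: nat]" "dom [i \<mapsto> 1 :: nat] - {i} = {}" by auto
      ultimately have "(i, the ([i \<mapsto> 1] i)) \<in> X" using that unfolding peel_closed_def by blast
      then show "e \<in> X" using i by simp
    qed
    ultimately show "?P 2 (?Q0, \<lambda>i. 1)"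
      unfolding prod.case by (intro conjI allI impI ballI)
  next
    fix k st st'
    assume k: "2 \<le> k" "k < N + 1" and step: "k_round S N m n k st st'" and P0: "?P k st"
    obtain Q1 t1 Q2 t2 where st: "st = (Q1, t1)" "st' = (Q2, t2)" by (meson surj_pair)
    note P0' = P0[unfolded st prod.case]
    note P = P0'[THEN conjunct1, rule_format]
      P0'[THEN conjunct2, THEN conjunct1, rule_format]
      P0'[THEN conjunct2, THEN conjunct2, THEN conjunct1, rule_format]
      P0'[THEN conjunct2, THEN conjunct2, THEN conjunct2, rule_format]
    have "1 \<le> k" using k by simp
    note eff = k_round_effect[OF step[unfolded st] this P(1)]
    have "card (Q2 s) = (\<Sum>k=1..<Suc k. \<Sum>i=1..N. n s i k)" if "s \<in> {1..S}" for s
      using eff(4)[OF that] P(2)[OF that] k by simp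
    moreover have "t2 i = (\<Sum>k=1..<Suc k. \<Sum>s=1..S. n s i k)" if "i \<in> {1..N}" for i
      using eff(3)[OF that] P(3)[OF that] k by simp
    moreover have "positions N t2 \<subseteq> X" if "peel_closed S Q2 X" for X
      by (rule eff(5)[OF that P(4)[OF peel_closed_mono[OF that eff(2)]]])
    ultimately show "?P (Suc k) st'"
      unfolding st prod.case by (intro conjI allI impI ballI eff(1))
  qed (use assms(3) in simp)
  note res = this[unfolded prod.case Suc_eq_plus1[symmetric] atLeastLessThanSuc_atLeastAtMost]
  note inv = res[THEN conjunct1, rule_format]
      res[THEN conjunct2, THEN conjunct1, rule_format]
      res[THEN conjunct2, THEN conjunct2, THEN conjunct1, rule_format]
      res[THEN conjunct2, THEN conjunct2, THEN conjunct2, rule_format]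
  show "queries_within N {1..N} (Q s)" for s by (rule inv(1))
  show "card (Q s) = (\<Sum>k=1..N. \<Sum>i=1..N. n s i k)" if "s \<in> {1..S}" for s
    using that by (rule inv(2))
  show "positions N (\<lambda>i. \<Sum>k=1..N. \<Sum>s=1..S. n s i k) \<subseteq> X" if "peel_closed S Q X" for X
  proof -
    have "positions N (\<lambda>i. \<Sum>k=1..N. \<Sum>s=1..S. n s i k) = positions N t"
      using inv(3) by (intro Sigma_cong refl) simp
    then show ?thesis using inv(4)[OF that] by simp
  qed
qed

section \<open>Existence of runs\<close>

text \<open>Sets containing \<open>i\<close> can be consumed by direct steps alone. The bound
  \<open>t \<le> t'\<close> keeps the counters positive for later rounds.\<close>

lemma direct_steps_exist:
  assumes "\<forall>U\<in>#A. i \<in> U \<and> U \<subseteq> {1..N}" and "\<forall>u\<in>{1..N}. 1 \<le> T u"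
  shows "\<exists>Q' t' D'. (query_step s T i ^^ size A) (Q, t, A + C, D) (Q', t', C, D') \<and> t \<le> t'"
  using assms(1)
proof (induction A arbitrary: Q t D)
  case empty
  show ?case by simp
next
  case (add U A)
  \<comment> \<open>All old positions are chosen to be 1, which is allowed because every counter in
    \<open>T\<close> is at least 1.\<close>
  let ?q = "\<lambda>u. if u \<in> U then Some (if u = i then t i + 1 else 1) else None"
  have U: "i \<in> U" "U \<subseteq> {1..N}" using add.prems by simp_all
  have "dom ?q = U" by (auto simp: dom_def)
  moreover have "?q i = Some (t i + 1)" using U(1) by simp
  moreover have "old_on (U - {i}) T ?q" unfolding old_on_def using U(2) assms(2) by auto
  ultimately have "query_step s T i (Q, t, add_mset U A + C, D)
      (Q(s := insert ?q (Q s)), t(i := t i + 1), add_mset U A + C - {#U#}, insert ?q D)"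
    using U(1) by (intro query_step.direct) simp_all
  then have step: "query_step s T i (Q, t, add_mset U A + C, D)
      (Q(s := insert ?q (Q s)), t(i := t i + 1), A + C, insert ?q D)"
    by simp
  have le: "t \<le> t(i := t i + 1)" by (simp add: le_fun_def)
  have "\<forall>U\<in>#A. i \<in> U \<and> U \<subseteq> {1..N}" using add.prems by simp
  from add.IH[OF this, of "Q(s := insert ?q (Q s))" "t(i := t i + 1)" "insert ?q D"]
  obtain Q' t' D' where
    "(query_step s T i ^^ size A)
       (Q(s := insert ?q (Q s)), t(i := t i + 1), A + C, insert ?q D) (Q', t', C, D')"
    "t(i := t i + 1) \<le> t'" by (elim exE conjE)
  then have "(query_step s T i ^^ size (add_mset U A)) (Q, t, add_mset U A + C, D) (Q', t', C, D') \<and> t \<le> t'"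
    using relpowp_Suc_I2[of "query_step s T i", OF step] order.trans[OF le] by simp
  then show ?case by (intro exI)
qed

lemma db_round_exists:
  assumes "\<And>J. J \<subseteq> {1..N} \<Longrightarrow> m s k * (card J choose k) \<le> (\<Sum>i\<in>J. n s i k)"
    and "m s k * (N choose k) = (\<Sum>i=1..N. n s i k)"
    and "\<forall>u\<in>{1..N}. 1 \<le> T u"
  shows "\<exists>Q' t'. db_round N m n k T s (Q, t) (Q', t') \<and> t \<le> t'"
proof -
  let ?C = "repeat_mset (m s k) (mset_set {U. U \<subseteq> {1..N} \<and> card U = k})"
  obtain A where A: "?C = (\<Sum>i\<in>{1..N}. A i)"
    "\<And>i. i \<in> {1..N} \<Longrightarrow> size (A i) = n s i k \<and> (\<forall>U\<in>#A i. i \<in> U)"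
    using assignment_exists[of N "m s k" k "\<lambda>i. n s i k", OF assms(1,2)] by metis
  \<comment> \<open>Before pass \<open>i\<close> the multiset consists of the shares assigned to
    files \<open>i..N\<close>; pass \<open>i\<close> uses up exactly the share
    \<open>A i\<close>.\<close>
  let ?P = "\<lambda>i (Q :: nat \<Rightarrow> query set, t1, C, D :: query set). C = (\<Sum>j\<in>{i..N}. A j) \<and> t \<le> t1"
  have "\<exists>st'. for_loop (\<lambda>i. query_step s T i ^^ n s i k) [1..<N + 1] (Q, t, ?C, {}) st' \<and> ?P (N + 1) st'"
  proof (rule for_loop_exists)
    show "?P 1 (Q, t, ?C, {})" using A(1) by simp
  next
    fix i st
    assume i: "1 \<le> i" "i < N + 1" and P: "?P i st"
    obtain Q1 C1 D1 and t1 :: "nat \<Rightarrow> nat" where st: "st = (Q1, t1, C1, D1)" by (metis prod_cases4)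
    have "{i..N} = insert i {Suc i..N}" using i by auto
    then have C1: "C1 = A i + (\<Sum>j\<in>{Suc i..N}. A j)" using P st by simp
    have iN: "i \<in> {1..N}" using i by simp
    have "\<forall>U\<in>#A i. i \<in> U \<and> U \<subseteq> {1..N}"
    proof
      fix U
      assume U: "U \<in># A i"
      have "?C = A i + (\<Sum>i\<in>{1..N} - {i}. A i)"
        unfolding A(1) using iN by (simp add: sum.remove)
      then have "U \<in># ?C" using U by simp
      from in_repeat_mset[OF this] show "i \<in> U \<and> U \<subseteq> {1..N}" using A(2)[OF iN] U by simp
    qed
    from direct_steps_exist[OF this assms(3),
        of s Q1 t1 "\<Sum>j\<in>{Suc i..N}. A j" D1]
    obtain Q2 t2 D2 where
      "(query_step s T i ^^ size (A i)) (Q1, t1, A i + (\<Sum>j\<in>{Suc i..N}. A j), D1)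
         (Q2, t2, (\<Sum>j\<in>{Suc i..N}. A j), D2)" "t1 \<le> t2"
      by (elim exE conjE)
    then have "(query_step s T i ^^ n s i k) st (Q2, t2, (\<Sum>j\<in>{Suc i..N}. A j), D2)"
        "?P (Suc i) (Q2, t2, (\<Sum>j\<in>{Suc i..N}. A j), D2)"
      using A(2)[OF iN] P unfolding st C1 by auto
    then show "\<exists>y. (query_step s T i ^^ n s i k) st y \<and> ?P (Suc i) y" by blast
  qed simp
  then show ?thesis unfolding db_round_def by fastforce
qed

lemma query_procedure_exists:
  assumes "\<And>s k J. s \<in> {1..S} \<Longrightarrow> k \<in> {2..N} \<Longrightarrow> J \<subseteq> {1..N} \<Longrightarrow>
      m s k * (card J choose k) \<le> (\<Sum>i\<in>J. n s i k)"
    and "\<And>s k. s \<in> {1..S} \<Longrightarrow> k \<in> {2..N} \<Longrightarrow> m s k * (N choose k) = (\<Sum>i=1..N. n s i k)"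
    and "N \<ge> 1"
  shows "\<exists>Q. query_procedure S N m n Q"
proof -
  let ?Q0 = "\<lambda>s. if s = 1 then {[i \<mapsto> 1] |i. i \<in> {1..N}} else {} :: query set"
  let ?P = "\<lambda>k (Q :: nat \<Rightarrow> query set, t). \<forall>u\<in>{1..N}. 1 \<le> (t u :: nat)"
  have "\<exists>st'. for_loop (k_round S N m n) [2..<N + 1] (?Q0, \<lambda>i. 1) st' \<and> ?P (N + 1) st'"
  proof (rule for_loop_exists)
    fix k st
    assume k: "2 \<le> k" "k < N + 1" and P: "?P k st"
    obtain Q1 t1 where st: "st = (Q1, t1)" by (meson surj_pair)
    have t1: "\<forall>u\<in>{1..N}. 1 \<le> t1 u" using P st by simp
    have "\<exists>st'. for_loop (db_round N m n k t1) [1..<S + 1] (Q1, t1) st' \<and> t1 \<le> snd st'"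
    proof (rule for_loop_exists[where P = "\<lambda>_ st. t1 \<le> snd st"])
      fix s st
      assume s: "1 \<le> s" "s < S + 1" and le: "t1 \<le> snd (st :: (nat \<Rightarrow> query set) \<times> (nat \<Rightarrow> nat))"
      obtain Q2 t2 where st: "st = (Q2, t2)" by (meson surj_pair)
      have "s \<in> {1..S}" "k \<in> {2..N}" using s k by simp_all
      then have "\<exists>Q' t'. db_round N m n k t1 s (Q2, t2) (Q', t') \<and> t2 \<le> t'"
        using t1 by (intro db_round_exists assms(1,2))
      then obtain Q3 t3 where "db_round N m n k t1 s (Q2, t2) (Q3, t3)" "t2 \<le> t3" by (elim exE conjE)
      then show "\<exists>y. db_round N m n k t1 s st y \<and> t1 \<le> snd y"
        using le unfolding st by (intro exI[of _ "(Q3, t3)"]) auto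
    qed simp_all
    then obtain st' where "for_loop (db_round N m n k t1) [1..<S + 1] (Q1, t1) st'" "t1 \<le> snd st'"
      by (elim exE conjE)
    moreover have "?P (Suc k) st'"
      using t1 le_funD[OF \<open>t1 \<le> snd st'\<close>] by (auto split: prod.splits intro: order.trans)
    ultimately show "\<exists>y. k_round S N m n k st y \<and> ?P (Suc k) y"
      unfolding st k_round_def prod.case by blast
  qed (use assms(3) in simp_all)
  then obtain st' where "for_loop (k_round S N m n) [2..<N + 1] (?Q0, \<lambda>i. 1) st'"
    by (elim exE conjE)
  then have "for_loop (k_round S N m n) [2..<N + 1] (?Q0, \<lambda>i. 1) (fst st', snd st')"
    by (simp only: prod.collapse)
  then show ?thesis unfolding query_procedure_def by blast
qed

section \<open>Hall's condition for the parameters of the scheme\<close>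

text \<open>The number that is rounded up is at most the integer \<open>k * phi S s k\<close>, so
  its ceiling is too.\<close>

lemma psi_le:
  assumes "N \<ge> 1"
  shows "psi N S s k \<le> k * phi S s k"
proof -
  have "real k * (real N - 1) / real N \<le> real k"
    using assms by (simp add: field_simps)
  then have "real k * (real N - 1) / real N * real (phi S s k) \<le> real k * real (phi S s k)"
    by (rule mult_right_mono) simp
  then show ?thesis unfolding psi_def by (simp add: nat_le_iff ceiling_le_iff)
qed

text \<open>Absorption turns the left side into \<open>j * ((j - 1) choose (k - 1))\<close>. Up to
  the factor \<open>phi S s k\<close> this is Hall's condition for \<open>j\<close> files with equal
  counts.\<close>

lemma times_binomial_le:
  assumes "j \<le> N" and "1 \<le> k"
  shows "k * (j choose k) \<le> j * ((N - 1) choose (k - 1))"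
proof -
  have "k * (j choose k) = j * ((j - 1) choose (k - 1))"
    using assms(2) by (intro times_binomial_minus1_eq) simp
  also have "\<dots> \<le> j * ((N - 1) choose (k - 1))"
    using assms(1) by (intro mult_left_mono binomial_right_mono) simp_all
  finally show ?thesis .
qed

text \<open>Absorbing twice shows that \<open>j choose k\<close> divided by \<open>j - 1\<close>
  equals \<open>j * ((j - 2) choose (k - 2))\<close> divided by \<open>k * (k - 1)\<close>, which
  grows with \<open>j\<close>. The claim compares \<open>j\<close> with \<open>N\<close>, cleared of
  denominators.\<close>

lemma binomial_ratio_le:
  assumes "1 \<le> j" and "j \<le> N" and "2 \<le> k"
  shows "(N - 1) * (j choose k) \<le> (j - 1) * (N choose k)"
proof -
  have binom: "k * (k - 1) * (a choose k) = a * (a - 1) * ((a - 2) choose (k - 2))" for a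
  proof -
    have "k * (k - 1) * (a choose k) = (k - 1) * (a * ((a - 1) choose (k - 1)))"
      using assms(3) times_binomial_minus1_eq[of k a] by simp
    also have "\<dots> = a * ((k - 1) * ((a - 1) choose (k - 1)))" by simp
    also have "\<dots> = a * ((a - 1) * ((a - 2) choose (k - 2)))"
      using assms(3) times_binomial_minus1_eq[of "k - 1" "a - 1"] by (simp add: numeral_2_eq_2)
    finally show ?thesis by simp
  qed
  have "k * (k - 1) * ((N - 1) * (j choose k)) = (N - 1) * (j * (j - 1) * ((j - 2) choose (k - 2)))"
    using binom[of j] by (simp only: mult.left_commute)
  also have "\<dots> \<le> (N - 1) * (N * (j - 1) * ((N - 2) choose (k - 2)))"
    using assms(2) by (intro mult_le_mono binomial_right_mono) simp_all
  also have "\<dots> = (j - 1) * (k * (k - 1) * (N choose k))"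
    unfolding binom by simp
  also have "\<dots> = k * (k - 1) * ((j - 1) * (N choose k))" by simp
  finally show ?thesis using assms(3) by simp
qed

text \<open>The demanded file is given whatever the other files leave of the total; by
  \<open>F_par_exact\<close> this remainder is not truncated.\<close>

lemma sum_F_par:
  assumes "d \<in> {1..N}" and "1 \<le> k"
  shows "(\<Sum>i=1..N. F_par N S d s i k) = (N choose k) * psi N S s k"
proof -
  have "(\<Sum>i=1..N. F_par N S d s i k) = F_par N S d s d k + (\<Sum>i\<in>{1..N} - {d}. F_par N S d s i k)"
    using assms(1) by (simp add: sum.remove)
  also have "(\<Sum>i\<in>{1..N} - {d}. F_par N S d s i k)
      = (\<Sum>i\<in>{1..N} - {d}. ((N - 1) choose (k - 1)) * phi S s k)"
    by (intro sum.cong) (auto simp: F_par_def)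
  also have "\<dots> = (N - 1) * ((N - 1) choose (k - 1)) * phi S s k" using assms(1) by simp
  finally show ?thesis
    using F_par_exact[of N k S s] assms by (simp add: F_par_def)
qed

text \<open>If \<open>d\<close> is not in \<open>J\<close>, the counts in \<open>J\<close> are equal
  and \<open>times_binomial_le\<close> applies. Otherwise the counts outside \<open>J\<close> are
  subtracted from the total: each is at most its \<open>(N - 1)\<close>-th part, so at least the
  fraction \<open>(j - 1) / (N - 1)\<close> remains for \<open>J\<close>, and
  \<open>binomial_ratio_le\<close> shows that this suffices.\<close>

lemma sum_F_par_hall:
  assumes "d \<in> {1..N}" and "2 \<le> k" and "J \<subseteq> {1..N}"
  shows "psi N S s k * (card J choose k) \<le> (\<Sum>i\<in>J. F_par N S d s i k)"
proof (cases "d \<in> J")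
  case False
  have "card J \<le> N" using card_mono[OF _ assms(3)] by simp
  have "psi N S s k * (card J choose k) \<le> k * phi S s k * (card J choose k)"
    using psi_le[of N S s k] assms(1) by (intro mult_right_mono) auto
  also have "\<dots> = k * (card J choose k) * phi S s k" by simp
  also have "\<dots> \<le> card J * ((N - 1) choose (k - 1)) * phi S s k"
    using assms(2) \<open>card J \<le> N\<close> by (intro mult_right_mono times_binomial_le) simp_all
  also have "\<dots> = (\<Sum>i\<in>J. ((N - 1) choose (k - 1)) * phi S s k)" by simp
  also have "\<dots> = (\<Sum>i\<in>J. F_par N S d s i k)"
    using False by (intro sum.cong) (auto simp: F_par_def)
  finally show ?thesis .
next
  case True
  define j where "j = card J"
  define b where "b = ((N - 1) choose (k - 1)) * phi S s k"
  define m where "m = psi N S s k"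
  have finJ: "finite J" using assms(3) finite_subset by blast
  have j: "1 \<le> j" "j \<le> N"
    unfolding j_def using True finJ card_mono[OF _ assms(3)] by (auto simp: Suc_le_eq card_gt_0_iff)
  have card: "card ({1..N} - J) = N - j"
    unfolding j_def using assms(3) finJ by (simp add: card_Diff_subset)
  have "(N choose k) * m = (\<Sum>i\<in>{1..N}. F_par N S d s i k)"
    unfolding m_def using sum_F_par[OF assms(1), of k] assms(2) by simp
  also have "\<dots> = (\<Sum>i\<in>{1..N} - J. F_par N S d s i k) + (\<Sum>i\<in>J. F_par N S d s i k)"
    using assms(3) by (intro sum.subset_diff) simp_all
  also have "(\<Sum>i\<in>{1..N} - J. F_par N S d s i k) = (\<Sum>i\<in>{1..N} - J. b)"
    using True unfolding b_def by (intro sum.cong) (auto simp: F_par_def)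
  finally have total: "(N choose k) * m = (N - j) * b + (\<Sum>i\<in>J. F_par N S d s i k)"
    using card by simp
  show ?thesis
  \<comment> \<open>The comparison below is multiplied by \<open>N - 1\<close>, which must not
    vanish.\<close>
  proof (cases "N = 1")
    case True
    then have "j choose k = 0" using j assms(2) by (intro binomial_eq_0) simp
    then show ?thesis unfolding j_def by (simp del: binomial_eq_0_iff)
  next
    case False
    have b: "(N - 1) * b \<le> (N choose k) * m"
      using F_par_exact[of N k S s] assms(1,2) unfolding b_def m_def by (simp add: mult.assoc)
    have "(N - 1) * ((N - j) * b + m * (j choose k))
        = (N - j) * ((N - 1) * b) + m * ((N - 1) * (j choose k))"
      by (simp only: distrib_left ac_simps)
    also have "\<dots> \<le> (N - j) * ((N choose k) * m) + m * ((j - 1) * (N choose k))"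
      using b binomial_ratio_le[OF j assms(2)] by (intro add_mono mult_left_mono) simp_all
    also have "\<dots> = ((N - j) + (j - 1)) * ((N choose k) * m)"
      by (simp only: distrib_left distrib_right ac_simps)
    also have "(N - j) + (j - 1) = N - 1" using j by simp
    finally have "(N - j) * b + m * (j choose k) \<le> (N choose k) * m"
      using False j by simp
    then show ?thesis using total unfolding m_def j_def by simp
  qed
qed

lemma QSet1_exists:
  assumes "d \<in> {1..N}"
  shows "\<exists>R. QSet1 S N j a d R"
proof -
  have "\<exists>Q. query_procedure S N (psi N S) (F_par N S d) Q"
  proof (rule query_procedure_exists)
    fix s k :: nat and J :: "nat set"
    assume "k \<in> {2..N}" "J \<subseteq> {1..N}"
    then show "psi N S s k * (card J choose k) \<le> (\<Sum>i\<in>J. F_par N S d s i k)"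
      using assms by (intro sum_F_par_hall) simp_all
  next
    fix s k :: nat
    assume "k \<in> {2..N}"
    then show "psi N S s k * (N choose k) = (\<Sum>i=1..N. F_par N S d s i k)"
      using sum_F_par[OF assms, of k S s] by (simp add: mult.commute)
  qed (use assms in simp)
  then show ?thesis unfolding QSet1_def by blast
qed

lemma QSet2_exists:
  assumes "N \<ge> 1"
  shows "\<exists>R. QSet2 S N \<omega> a R"
proof -
  have "\<exists>Q. query_procedure S N (\<lambda>s k. k * phi S s k) (\<lambda>s i k. ((N - 1) choose (k - 1)) * phi S s k) Q"
  proof (rule query_procedure_exists)
    fix s k :: nat and J :: "nat set"
    assume "k \<in> {2..N}" "J \<subseteq> {1..N}"
    moreover from this have "card J \<le> N" using card_mono[of "{1..N}" J] by simp
    ultimately have "k * (card J choose k) \<le> card J * ((N - 1) choose (k - 1))"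
      by (intro times_binomial_le) simp_all
    then have "k * (card J choose k) * phi S s k \<le> card J * ((N - 1) choose (k - 1)) * phi S s k"
      by (rule mult_right_mono) simp
    then show "k * phi S s k * (card J choose k) \<le> (\<Sum>i\<in>J. ((N - 1) choose (k - 1)) * phi S s k)"
      by (simp add: ac_simps)
  next
    fix s k :: nat
    assume "k \<in> {2..N}"
    then have "k * (N choose k) = N * ((N - 1) choose (k - 1))"
      by (intro times_binomial_minus1_eq) simp
    then have "k * (N choose k) * phi S s k = N * ((N - 1) choose (k - 1)) * phi S s k" by simp
    then show "k * phi S s k * (N choose k) = (\<Sum>i=1..N. ((N - 1) choose (k - 1)) * phi S s k)"
      by (simp add: ac_simps)
  qed (use assms in simp)
  then show ?thesis unfolding QSet2_def by blast
qed

section \<open>Requests of one user\<close>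

text \<open>In round 1 only database 1 is asked, once per file. This matches the initial state of
  the procedure, as \<open>query_procedure_effect\<close> requires.\<close>

lemma phi_1:
  assumes "S \<ge> 2"
  shows "phi S s 1 = (if s = 1 then 1 else 0)"
proof -
  have "real (phi S s 1) = (if s = 1 then 1 else 0)"
    using phi_exact[OF assms, of 1 s] g_par_1[OF assms] by (simp add: f_par_def)
  then show ?thesis by (simp split: if_splits)
qed

text \<open>For \<open>N \<ge> 2\<close> the fraction \<open>(N - 1) / N\<close> lies strictly
  between 0 and 1 and rounds up to 1; for \<open>N = 1\<close> it would be 0.\<close>

lemma psi_1:
  assumes "S \<ge> 2" and "N \<ge> 2"
  shows "psi N S s 1 = (if s = 1 then 1 else 0)"
proof -
  have "\<lceil>(real N - 1) / real N\<rceil> = 1"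
    using assms(2) by (simp add: ceiling_eq_iff)
  then show ?thesis unfolding psi_def phi_1[OF assms(1)] by simp
qed

lemma F_par_1:
  assumes "S \<ge> 2" and "N \<ge> 2"
  shows "F_par N S d s i 1 = (if s = 1 then 1 else 0)"
  using assms(2) unfolding F_par_def phi_1[OF assms(1)] psi_1[OF assms] by simp

lemma sum_F_par_other:
  assumes "S \<ge> 2" and "N \<ge> 1" and "i \<noteq> d"
  shows "(\<Sum>k=1..N. \<Sum>s=1..S. F_par N S d s i k) = S ^ (N - 1)"
  using sum_binomial_phi[OF assms(1,2)] assms(3) by (simp add: F_par_def)

text \<open>The counts of all files add up to \<open>q_par N S\<close>, and each of the
  \<open>N - 1\<close> undemanded files accounts for \<open>S ^ (N - 1)\<close>. So a base user's
  queries reveal \<open>H_par N S\<close> positions of the demanded file.\<close>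

lemma sum_F_par_same:
  assumes "S \<ge> 2" and "N \<ge> 1"
  shows "(\<Sum>k=1..N. \<Sum>s=1..S. F_par N S d s d k) = H_par N S"
proof -
  have "q_par N S = (\<Sum>k=1..N. \<Sum>s=1..S. F_par N S d s d k + (N - 1) * (((N - 1) choose (k - 1)) * phi S s k))"
    unfolding q_par_def
  proof (intro sum.cong refl)
    fix k s
    assume "k \<in> {1..N}"
    then show "(N choose k) * psi N S s k
        = F_par N S d s d k + (N - 1) * (((N - 1) choose (k - 1)) * phi S s k)"
      using F_par_exact[of N k S s] assms(2) by (simp add: F_par_def mult.assoc)
  qed
  also have "\<dots> = (\<Sum>k=1..N. \<Sum>s=1..S. F_par N S d s d k) + (N - 1) * S ^ (N - 1)"
    by (simp only: sum_binomial_phi[OF assms, symmetric] sum.distrib sum_distrib_left)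
  finally show ?thesis unfolding H_par_def by simp
qed

lemma q_par_le:
  assumes "S \<ge> 2" and "N \<ge> 1"
  shows "q_par N S \<le> N * S ^ (N - 1)"
proof -
  have "q_par N S \<le> (\<Sum>k=1..N. \<Sum>s=1..S. N * (((N - 1) choose (k - 1)) * phi S s k))"
    unfolding q_par_def
  proof (intro sum_mono)
    fix k s
    assume "k \<in> {1..N}"
    then have "k * (N choose k) = N * ((N - 1) choose (k - 1))"
      by (intro times_binomial_minus1_eq) simp
    moreover have "(N choose k) * psi N S s k \<le> (N choose k) * (k * phi S s k)"
      using psi_le[OF assms(2)] by (rule mult_left_mono) simp
    ultimately show "(N choose k) * psi N S s k \<le> N * (((N - 1) choose (k - 1)) * phi S s k)"
      by (metis mult.assoc mult.commute)
  qed
  also have "\<dots> = N * S ^ (N - 1)"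
    by (simp only: sum_binomial_phi[OF assms, symmetric] sum_distrib_left)
  finally show ?thesis .
qed

text \<open>Ensures that \<open>S ^ (N - 1) - H_par N S\<close>, the number of sums in a cache, is
  not truncated.\<close>

lemma H_par_le:
  assumes "S \<ge> 2" and "N \<ge> 1"
  shows "H_par N S \<le> S ^ (N - 1)"
proof -
  have "q_par N S \<le> (N - 1 + 1) * S ^ (N - 1)" using q_par_le[OF assms] assms(2) by simp
  then show ?thesis unfolding H_par_def distrib_right by simp
qed

section \<open>From queries to requests and linear equations\<close>

text \<open>Labels carry their file, so symbols of different files share none. Nothing cancels, and
  the parity condition becomes a union.\<close>

lemma request_of_eq_UN:
  assumes "\<forall>i x. \<forall>l\<in>\<omega> i x. fst l = i"
  shows "request_of \<omega> a q = (\<Union>i\<in>dom q. \<omega> i (a i (the (q i))))"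
proof -
  have "odd (card {i \<in> dom q. l \<in> \<omega> i (a i (the (q i)))}) \<longleftrightarrow>
      (\<exists>i\<in>dom q. l \<in> \<omega> i (a i (the (q i))))" for l
  proof (cases "\<exists>i\<in>dom q. l \<in> \<omega> i (a i (the (q i)))")
    case True
    moreover have "i = fst l" if "l \<in> \<omega> i x" for i x using assms that by metis
    ultimately have "{i \<in> dom q. l \<in> \<omega> i (a i (the (q i)))} = {fst l}" by auto
    then show ?thesis using True by simp
  next
    case False
    then have "{i \<in> dom q. l \<in> \<omega> i (a i (the (q i)))} = {}" by blast
    then have "\<not> odd (card {i \<in> dom q. l \<in> \<omega> i (a i (the (q i)))})"
      by (simp only: card.empty even_zero not_not)
    then show ?thesis using False by blast
  qed
  then show ?thesis unfolding request_of_def by auto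
qed

lemma bit_add_eq_0_iff: "(x :: bit) + y = 0 \<longleftrightarrow> x = y"
  by (cases x; cases y) simp_all

text \<open>The hypothesis \<open>key\<close> singles out a subfile \<open>j\<close> in which every
  symbol leaves exactly one label, from which the symbol can be read off. This covers both plain
  subsubfiles and sums of two; \<open>j\<close> will be the subfile of the user in question.\<close>

lemma query_requests_effect:
  fixes \<omega> :: "nat \<Rightarrow> nat \<Rightarrow> request"
  assumes "query_procedure S N m n Q" and "S \<ge> 1" and "N \<ge> 1"
    and "\<forall>s\<in>{1..S}. \<forall>i\<in>{1..N}. n s i 1 = (if s = 1 then 1 else 0)"
    and a: "\<forall>i\<in>{1..N}. inj (a i)"
    and fst: "\<forall>i x. \<forall>l\<in>\<omega> i x. fst l = i"
    and fin: "\<forall>i x. finite (\<omega> i x)"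
    and key: "\<forall>i\<in>{1..N}. \<forall>x x'. (i, j, x) \<in> \<omega> i x' \<longleftrightarrow> x = x'"
  shows "finite (request_of \<omega> a ` Q s)"
    and "s \<in> {1..S} \<Longrightarrow> card (request_of \<omega> a ` Q s) = (\<Sum>k=1..N. \<Sum>i=1..N. n s i k)"
    and "r \<in> request_of \<omega> a ` Q s \<Longrightarrow> \<exists>l\<in>r. fst (snd l) = j"
    and "r \<in> request_of \<omega> a ` Q s \<Longrightarrow> l \<in> r \<Longrightarrow> \<exists>i\<in>{1..N}. \<exists>x. l \<in> \<omega> i x"
    and "\<forall>s\<in>{1..S}. \<forall>r\<in>request_of \<omega> a ` Q s. (\<Sum>l\<in>r. e l) = (0 :: bit) \<Longrightarrow>
      i \<in> {1..N} \<Longrightarrow> \<tau> \<in> {1..\<Sum>k=1..N. \<Sum>s=1..S. n s i k} \<Longrightarrow> (\<Sum>l\<in>\<omega> i (a i \<tau>). e l) = 0"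
proof -
  note effect = query_procedure_effect[OF assms(1-4)]
  note UN = request_of_eq_UN[OF fst]
  have Q: "finite (Q s)" "q \<in> Q s \<Longrightarrow> dom q \<subseteq> {1..N}" for s q
    using effect(1)[of s] unfolding queries_within_def by blast+
  have nonempty: "dom q \<noteq> {}" if "q \<in> Q s" for s q
  proof -
    have "card (dom q) \<in> {1..N}" using effect(1)[of s] that unfolding queries_within_def by blast
    then show ?thesis by auto
  qed
  show "finite (request_of \<omega> a ` Q s)" using Q(1) by simp
  have mem: "(i, j, x) \<in> request_of \<omega> a q \<longleftrightarrow> i \<in> dom q \<and> x = a i (the (q i))" 
    if q: "dom q \<subseteq> {1..N}" for i x q
  proof -
    have "(i, j, x) \<in> request_of \<omega> a q \<longleftrightarrow> (\<exists>u\<in>dom q. (i, j, x) \<in> \<omega> u (a u (the (q u))))"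
      unfolding UN by blast
    also have "\<dots> \<longleftrightarrow> i \<in> dom q \<and> (i, j, x) \<in> \<omega> i (a i (the (q i)))"
      using fst by fastforce
    also have "\<dots> \<longleftrightarrow> i \<in> dom q \<and> x = a i (the (q i))"
      using key q by blast
    finally show ?thesis .
  qed
  \<comment> \<open>The labels in subfile \<open>j\<close> determine the query, so passing to
    requests merges no two queries.\<close>
  have inj: "inj_on (request_of \<omega> a) (Q s)" for s
  proof (rule inj_onI)
    fix q q'
    assume q: "q \<in> Q s" "q' \<in> Q s" "request_of \<omega> a q = request_of \<omega> a q'"
    have eq: "i \<in> dom q \<and> x = a i (the (q i)) \<longleftrightarrow> i \<in> dom q' \<and> x = a i (the (q' i))" for i x
      using mem[OF Q(2)[OF q(1)], of i x] mem[OF Q(2)[OF q(2)], of i x] q(3) by simp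
    show "q = q'"
    proof
      fix i
      show "q i = q' i"
      proof (cases "i \<in> dom q")
        case True
        then have i: "i \<in> dom q'" "a i (the (q i)) = a i (the (q' i))"
          using eq[of i "a i (the (q i))"] by simp_all
        have "i \<in> {1..N}" using Q(2)[OF q(1)] True by blast
        then have "the (q i) = the (q' i)" using a i(2) by (simp add: inj_eq)
        then show ?thesis using True i(1) by auto
      next
        case False
        then have "i \<notin> dom q'" using eq[of i "a i (the (q' i))"] by simp
        then show ?thesis using False by (simp add: domIff)
      qed
    qed
  qed
  show "s \<in> {1..S} \<Longrightarrow> card (request_of \<omega> a ` Q s) = (\<Sum>k=1..N. \<Sum>i=1..N. n s i k)"
    using effect(2) inj by (simp add: card_image)
  show "\<exists>l\<in>r. fst (snd l) = j" if r: "r \<in> request_of \<omega> a ` Q s"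
  proof -
    obtain q where q: "q \<in> Q s" "r = request_of \<omega> a q" using r by blast
    obtain i where "i \<in> dom q" using nonempty[OF q(1)] by blast
    then have "(i, j, a i (the (q i))) \<in> r" using mem[OF Q(2)[OF q(1)]] q(2) by blast
    then show ?thesis by force
  qed
  show "\<exists>i\<in>{1..N}. \<exists>x. l \<in> \<omega> i x" if r: "r \<in> request_of \<omega> a ` Q s" and l: "l \<in> r"
  proof -
    obtain q where q: "q \<in> Q s" "r = request_of \<omega> a q" using r by blast
    obtain i where "i \<in> dom q" "l \<in> \<omega> i (a i (the (q i)))" using l unfolding q(2) UN by blast
    then show ?thesis using Q(2)[OF q(1)] by blast
  qed
  show "(\<Sum>l\<in>\<omega> i (a i \<tau>). e l) = 0"
    if zero: "\<forall>s\<in>{1..S}. \<forall>r\<in>request_of \<omega> a ` Q s. (\<Sum>l\<in>r. e l) = 0"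
      and i: "i \<in> {1..N}" and \<tau>: "\<tau> \<in> {1..\<Sum>k=1..N. \<Sum>s=1..S. n s i k}"
  proof -
    define E where "E i \<tau> = (\<Sum>l\<in>\<omega> i (a i \<tau>). e l)" for i \<tau>
    \<comment> \<open>If a request sums to zero and all its symbols but one vanish, so does the
      last. Hence the vanishing symbols are closed under peeling.\<close>
    have "peel_closed S Q {(i, \<tau>). E i \<tau> = 0}"
      unfolding peel_closed_def
    proof (intro ballI impI)
      fix s q i
      assume s: "s \<in> {1..S}" and q: "q \<in> Q s" and i: "i \<in> dom q"
        and known: "\<forall>u\<in>dom q - {i}. (u, the (q u)) \<in> {(i, \<tau>). E i \<tau> = 0}"
      have finq: "finite (dom q)" using Q(2)[OF q] finite_subset by blast
      have "0 = (\<Sum>l\<in>request_of \<omega> a q. e l)" using zero s q by simp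
      also have "\<dots> = (\<Sum>u\<in>dom q. E u (the (q u)))"
        unfolding UN E_def
      proof (rule sum.UNION_disjoint[OF finq])
        show "\<forall>u\<in>dom q. \<forall>v\<in>dom q. u \<noteq> v \<longrightarrow> \<omega> u (a u (the (q u))) \<inter> \<omega> v (a v (the (q v))) = {}"
          using fst by (metis disjoint_iff)
      qed (use fin in blast)
      also have "\<dots> = E i (the (q i)) + (\<Sum>u\<in>dom q - {i}. E u (the (q u)))"
        using finq i by (rule sum.remove)
      also have "(\<Sum>u\<in>dom q - {i}. E u (the (q u))) = 0"
        using known by (intro sum.neutral) simp
      finally show "(i, the (q i)) \<in> {(i, \<tau>). E i \<tau> = 0}" by simp
    qed
    from effect(3)[OF this] have "(i, \<tau>) \<in> {(i, \<tau>). E i \<tau> = 0}" using i \<tau> by (rule_tac subsetD) auto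
    then show ?thesis by (simp add: E_def)
  qed
qed

lemma QSet1_effect:
  assumes "QSet1 S N j a d R" and "S \<ge> 2" and "N \<ge> 2" and "d \<in> {1..N}"
    and "\<forall>i\<in>{1..N}. inj (a i)"
  shows "finite (R s)"
    and "(\<Sum>s=1..S. card (R s)) = q_par N S"
    and "r \<in> R s \<Longrightarrow> \<exists>l\<in>r. fst (snd l) = j"
    and "r \<in> R s \<Longrightarrow> l \<in> r \<Longrightarrow> fst (snd l) = j"
    and "\<forall>s\<in>{1..S}. \<forall>r\<in>R s. (\<Sum>l\<in>r. e l) = (0 :: bit) \<Longrightarrow>
      i \<in> {1..N} \<Longrightarrow> \<tau> \<in> {1..if i = d then H_par N S else S ^ (N - 1)} \<Longrightarrow> e (i, j, a i \<tau>) = 0"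
proof -
  let ?\<omega> = "\<lambda>i x. {(i, j, x)} :: request"
  obtain Q where Q: "query_procedure S N (psi N S) (F_par N S d) Q"
    and R: "R = (\<lambda>s. request_of ?\<omega> a ` Q s)"
    using assms(1) unfolding QSet1_def by blast
  have ge: "1 \<le> S" "1 \<le> N" using assms(2,3) by simp_all
  have n1: "\<forall>s\<in>{1..S}. \<forall>i\<in>{1..N}. F_par N S d s i 1 = (if s = 1 then 1 else 0)"
    using F_par_1[OF assms(2,3)] by blast
  have \<omega>: "\<forall>i x. \<forall>l\<in>?\<omega> i x. fst l = i" "\<forall>i x. finite (?\<omega> i x)"
    "\<forall>i\<in>{1..N}. \<forall>x x'. (i, j, x) \<in> ?\<omega> i x' \<longleftrightarrow> x = x'"
    by simp_all
  note effect = query_requests_effect[OF Q ge n1 assms(5) \<omega>]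
  show "finite (R s)" unfolding R by (rule effect(1))
  have "(\<Sum>s=1..S. card (R s)) = (\<Sum>s=1..S. \<Sum>k=1..N. \<Sum>i=1..N. F_par N S d s i k)"
    unfolding R by (intro sum.cong refl effect(2))
  also have "\<dots> = (\<Sum>s=1..S. \<Sum>k=1..N. (N choose k) * psi N S s k)"
    by (intro sum.cong refl sum_F_par assms(4)) simp
  also have "\<dots> = q_par N S" unfolding q_par_def by (rule sum.swap)
  finally show "(\<Sum>s=1..S. card (R s)) = q_par N S" .
  show "\<exists>l\<in>r. fst (snd l) = j" if "r \<in> R s"
    using that unfolding R by (rule effect(3))
  show "fst (snd l) = j" if r: "r \<in> R s" "l \<in> r"
    using effect(4)[OF r[unfolded R]] by auto
  show "e (i, j, a i \<tau>) = 0"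
    if zero: "\<forall>s\<in>{1..S}. \<forall>r\<in>R s. (\<Sum>l\<in>r. e l) = 0"
      and i: "i \<in> {1..N}" and \<tau>: "\<tau> \<in> {1..if i = d then H_par N S else S ^ (N - 1)}"
  proof -
    have "(\<Sum>k=1..N. \<Sum>s=1..S. F_par N S d s i k) = (if i = d then H_par N S else S ^ (N - 1))"
      using sum_F_par_same[OF assms(2) ge(2)] sum_F_par_other[OF assms(2) ge(2)] by simp
    from effect(5)[OF zero[unfolded R] i, unfolded this, OF \<tau>] show ?thesis by simp
  qed
qed

text \<open>Since \<open>j' i\<close> differs from \<open>j\<close>, the two labels of a symbol do
  not cancel. In characteristic 2 a vanishing symbol then means that \<open>e\<close> agrees on
  them.\<close>

lemma QSet2_effect:
  assumes "QSet2 S N (\<lambda>i x. sym_diff {(i, j' i, x)} {(i, j, x)}) a R" and "S \<ge> 2" and "N \<ge> 1"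
    and "\<forall>i\<in>{1..N}. inj (a i)" and "\<forall>i\<in>{1..N}. j' i \<noteq> j"
  shows "finite (R s)"
    and "(\<Sum>s=1..S. card (R s)) = N * S ^ (N - 1)"
    and "r \<in> R s \<Longrightarrow> \<exists>l\<in>r. fst (snd l) = j"
    and "r \<in> R s \<Longrightarrow> l \<in> r \<Longrightarrow> fst (snd l) \<in> insert j (j' ` {1..N})"
    and "\<forall>s\<in>{1..S}. \<forall>r\<in>R s. (\<Sum>l\<in>r. e l) = (0 :: bit) \<Longrightarrow>
      i \<in> {1..N} \<Longrightarrow> \<tau> \<in> {1..S ^ (N - 1)} \<Longrightarrow> e (i, j' i, a i \<tau>) = e (i, j, a i \<tau>)"
proof -
  let ?\<omega> = "\<lambda>i x. sym_diff {(i, j' i, x)} {(i, j, x)} :: request"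
  obtain Q where Q: "query_procedure S N (\<lambda>s k. k * phi S s k)
      (\<lambda>s i k. ((N - 1) choose (k - 1)) * phi S s k) Q"
    and R: "R = (\<lambda>s. request_of ?\<omega> a ` Q s)"
    using assms(1) unfolding QSet2_def by blast
  have S: "1 \<le> S" using assms(2) by simp
  have n1: "\<forall>s\<in>{1..S}. \<forall>i\<in>{1..N}. ((N - 1) choose (1 - 1)) * phi S s 1 = (if s = 1 then 1 else 0)"
    using phi_1[OF assms(2)] by simp
  have \<omega>: "\<forall>i x. \<forall>l\<in>?\<omega> i x. fst l = i" "\<forall>i x. finite (?\<omega> i x)"
    "\<forall>i\<in>{1..N}. \<forall>x x'. (i, j, x) \<in> ?\<omega> i x' \<longleftrightarrow> x = x'"
    using assms(5) by auto
  note effect = query_requests_effect[OF Q S assms(3) n1 assms(4) \<omega>]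
  show "finite (R s)" unfolding R by (rule effect(1))
  have "(\<Sum>s=1..S. card (R s))
      = (\<Sum>s=1..S. \<Sum>k=1..N. \<Sum>i=1..N. ((N - 1) choose (k - 1)) * phi S s k)"
    unfolding R by (intro sum.cong refl effect(2))
  also have "\<dots> = (\<Sum>s=1..S. \<Sum>k=1..N. N * (((N - 1) choose (k - 1)) * phi S s k))" by simp
  also have "\<dots> = N * (\<Sum>s=1..S. \<Sum>k=1..N. ((N - 1) choose (k - 1)) * phi S s k)"
    by (simp only: sum_distrib_left)
  also have "(\<Sum>s=1..S. \<Sum>k=1..N. ((N - 1) choose (k - 1)) * phi S s k) = S ^ (N - 1)"
    unfolding sum_binomial_phi[OF assms(2,3), symmetric] by (rule sum.swap)
  finally show "(\<Sum>s=1..S. card (R s)) = N * S ^ (N - 1)" .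
  show "\<exists>l\<in>r. fst (snd l) = j" if "r \<in> R s"
    using that unfolding R by (rule effect(3))
  show "fst (snd l) \<in> insert j (j' ` {1..N})" if r: "r \<in> R s" "l \<in> r"
    using effect(4)[OF r[unfolded R]] by auto
  show "e (i, j' i, a i \<tau>) = e (i, j, a i \<tau>)"
    if zero: "\<forall>s\<in>{1..S}. \<forall>r\<in>R s. (\<Sum>l\<in>r. e l) = 0"
      and i: "i \<in> {1..N}" and \<tau>: "\<tau> \<in> {1..S ^ (N - 1)}"
  proof -
    have "?\<omega> i (a i \<tau>) = {(i, j' i, a i \<tau>), (i, j, a i \<tau>)}" "(i, j' i, a i \<tau>) \<noteq> (i, j, a i \<tau>)"
      using assms(5) i by auto
    moreover have "(\<Sum>l\<in>?\<omega> i (a i \<tau>). e l) = 0"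
      using effect(5)[OF zero[unfolded R] i, unfolded sum_binomial_phi[OF assms(2,3)], OF \<tau>] .
    ultimately have "e (i, j' i, a i \<tau>) + e (i, j, a i \<tau>) = 0" by simp
    then show ?thesis by (simp only: bit_add_eq_0_iff)
  qed
qed

section \<open>Delivery\<close>

lemma inj_on_base_set:
  assumes "base_set N K d B"
  shows "inj_on d B"
proof (rule eq_card_imp_inj_on)
  show "finite B" using assms finite_subset unfolding base_set_def by blast
  show "card (d ` B) = card B" using assms unfolding base_set_def by simp
qed

text \<open>Decoding yields positions, whereas the claim is about symbols. The permutation of the
  demanded file fixes everything above \<open>H_par N S\<close>, so symbols up to
  \<open>H_par N S\<close> come from positions up to \<open>H_par N S\<close>.\<close>

lemma base_subfiles_decoded:
  fixes e :: "nat \<times> nat \<times> nat \<Rightarrow> bit"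
  assumes "QSet1 S N j a d R" and "S \<ge> 2" and "N \<ge> 2" and "d \<in> {1..N}"
    and perm: "\<forall>i\<in>{1..N}. a i permutes {1..S ^ (N - 1)}"
    and fixed: "\<forall>x\<in>{H_par N S + 1..S ^ (N - 1)}. a d x = x"
    and zero: "\<forall>s\<in>{1..S}. \<forall>r\<in>R s. (\<Sum>l\<in>r. e l) = 0"
    and i: "i \<in> {1..N}" and x: "x \<in> {1..S ^ (N - 1)}" "i = d \<Longrightarrow> x \<le> H_par N S"
  shows "e (i, j, x) = 0"
proof -
  have inj: "\<forall>i\<in>{1..N}. inj (a i)" using perm permutes_inj by blast
  have "x \<in> a i ` {1..S ^ (N - 1)}" using permutes_image perm i x(1) by blast
  then obtain \<tau> where \<tau>: "\<tau> \<in> {1..S ^ (N - 1)}" "x = a i \<tau>" by blast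
  have "\<tau> \<le> H_par N S" if "i = d"
  proof (rule ccontr)
    assume "\<not> \<tau> \<le> H_par N S"
    then have "a d \<tau> = \<tau>" using fixed \<tau>(1) by simp
    then show False using \<tau>(2) x(2)[OF that] that \<open>\<not> \<tau> \<le> H_par N S\<close> by simp
  qed
  then have "\<tau> \<in> {1..if i = d then H_par N S else S ^ (N - 1)}" using \<tau>(1) by simp
  from QSet1_effect(5)[OF assms(1-4) inj zero i this] show ?thesis using \<tau>(2) by simp
qed

lemma nonbase_subfiles_linked:
  fixes e :: "nat \<times> nat \<times> nat \<Rightarrow> bit"
  assumes "QSet2 S N (\<lambda>i x. sym_diff {(i, j' i, x)} {(i, j, x)}) a R" and "S \<ge> 2" and "N \<ge> 1"
    and perm: "\<forall>i\<in>{1..N}. a i permutes {1..S ^ (N - 1)}"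
    and "\<forall>i\<in>{1..N}. j' i \<noteq> j"
    and zero: "\<forall>s\<in>{1..S}. \<forall>r\<in>R s. (\<Sum>l\<in>r. e l) = 0"
    and i: "i \<in> {1..N}" and x: "x \<in> {1..S ^ (N - 1)}"
  shows "e (i, j, x) = e (i, j' i, x)"
proof -
  have inj: "\<forall>i\<in>{1..N}. inj (a i)" using perm permutes_inj by blast
  have "x \<in> a i ` {1..S ^ (N - 1)}" using permutes_image perm i x by blast
  then obtain \<tau> where \<tau>: "\<tau> \<in> {1..S ^ (N - 1)}" "x = a i \<tau>" by blast
  from QSet2_effect(5)[OF assms(1-3) inj assms(5) zero i \<tau>(1)] show ?thesis using \<tau>(2) by simp
qed

text \<open>Among the labels of file \<open>d u\<close> in base subfiles, the queries of base users
  leave open only those above \<open>H_par N S\<close> in the subfile of the base user demanding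
  that file. There the cache supplies the missing equation, directly or through a link.\<close>

lemma delivery_decoding:
  fixes e :: "nat \<times> nat \<times> nat \<Rightarrow> bit"
  assumes S: "S \<ge> 2" and N: "N \<ge> 2" and p: "p permutes {1..K}" and d: "d ` {1..K} = {1..N}"
    and B: "base_set N K d B" and choices: "user_choices S N K d B P \<rho>"
    and Q: "delivery_queries S N K p d B P \<rho> Q"
    and zero: "\<forall>s\<in>{1..S}. \<forall>r\<in>Q s. (\<Sum>l\<in>r. e l) = 0"
    and u: "u \<in> {1..K}"
    and cached: "\<forall>t\<in>{H_par N S + 1..S ^ (N - 1)}. (\<Sum>i=1..N. e (i, p u, t)) = 0"
    and j: "j \<in> {1..K}" and x: "x \<in> {1..S ^ (N - 1)}"
  shows "e (d u, j, x) = 0"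
proof -
  have BK: "B \<subseteq> {1..K}" using B by (simp add: base_set_def)
  have dN: "d c \<in> {1..N}" if "c \<in> {1..K}" for c using d that by blast
  have perm: "\<forall>i\<in>{1..N}. P c i permutes {1..S ^ (N - 1)}" if "c \<in> {1..K}" for c
    using choices that unfolding user_choices_def by blast
  have fixed: "\<forall>x\<in>{H_par N S + 1..S ^ (N - 1)}. P c (d c) x = x" if "c \<in> B" for c
    using choices that unfolding user_choices_def by blast
  have \<rho>: "inj_on (\<rho> c) {1..N} \<and> \<rho> c ` {1..N} \<subseteq> B \<and>
      d (\<rho> c (d c)) = d c \<and> (\<forall>j\<in>{1..N} - {d c}. d (\<rho> c j) \<noteq> j)" if "c \<in> {1..K} - B" for c
    using choices that unfolding user_choices_def by blast
  have \<rho>B: "\<rho> c i \<in> B" if "c \<in> {1..K} - B" "i \<in> {1..N}" for c i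
    using \<rho>[OF that(1)] that(2) by blast
  obtain Qc where Q1: "\<forall>c\<in>B. QSet1 S N (p c) (P c) (d c) (Qc c)"
    and Q2: "\<forall>c\<in>{1..K} - B.
        QSet2 S N (\<lambda>i x. sym_diff {(i, p (\<rho> c i), x)} {(i, p c, x)}) (P c) (Qc c)"
    and QU: "Q = (\<lambda>s. \<Union>c\<in>{1..K}. Qc c s)"
    using Q unfolding delivery_queries_def by (elim exE conjE)
  have zeroc: "\<forall>s\<in>{1..S}. \<forall>r\<in>Qc c s. (\<Sum>l\<in>r. e l) = 0" if "c \<in> {1..K}" for c
    using zero that unfolding QU by blast
  have base: "e (i, p c, y) = 0"
    if "c \<in> B" "i \<in> {1..N}" "y \<in> {1..S ^ (N - 1)}" "i = d c \<Longrightarrow> y \<le> H_par N S" for c i y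
  proof -
    have c: "c \<in> {1..K}" using that(1) BK by blast
    have "QSet1 S N (p c) (P c) (d c) (Qc c)" using Q1 that(1) by blast
    from base_subfiles_decoded[OF this S N dN[OF c] perm[OF c] fixed[OF that(1)] zeroc[OF c] that(2-4)]
    show ?thesis by simp
  qed
  have linked: "e (i, p c, y) = e (i, p (\<rho> c i), y)"
    if c: "c \<in> {1..K} - B" and i: "i \<in> {1..N}" and y: "y \<in> {1..S ^ (N - 1)}" for c i y
  proof (rule nonbase_subfiles_linked[where j' = "\<lambda>i. p (\<rho> c i)" and a = "P c"])
    show "\<forall>i\<in>{1..N}. p (\<rho> c i) \<noteq> p c"
      using \<rho>B[OF c] c permutes_inj[OF p] by (metis DiffD2 injD)
    show "QSet2 S N (\<lambda>i x. sym_diff {(i, p (\<rho> c i), x)} {(i, p c, x)}) (P c) (Qc c)"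
      using Q2 c by (rule bspec)
    show "\<forall>i\<in>{1..N}. P c i permutes {1..S ^ (N - 1)}" using perm c by blast
    show "\<forall>s\<in>{1..S}. \<forall>r\<in>Qc c s. (\<Sum>l\<in>r. e l) = 0" using zeroc c by blast
  qed (use S N i y in simp_all)
  have du: "d u \<in> {1..N}" using dN u by blast
  \<comment> \<open>A cached sum runs over all files; once the others vanish, a single term is
    left.\<close>
  have cancel: "e (d u, p u, y) = 0"
    if y: "y \<in> {1..S ^ (N - 1)}" "H_par N S < y"
      and others: "\<forall>i\<in>{1..N} - {d u}. e (i, p u, y) = 0" for y
  proof -
    have "0 = (\<Sum>i=1..N. e (i, p u, y))" using cached y by simp
    also have "\<dots> = e (d u, p u, y) + (\<Sum>i\<in>{1..N} - {d u}. e (i, p u, y))"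
      using du by (intro sum.remove) simp_all
    also have "(\<Sum>i\<in>{1..N} - {d u}. e (i, p u, y)) = 0"
      using others by (intro sum.neutral)
    finally show ?thesis by simp
  qed
  have wanted: "e (d u, p b, x) = 0" if b: "b \<in> B" for b
  proof (cases "d b = d u \<and> H_par N S < x")
    case False
    then show ?thesis by (intro base b du x) auto
  next
    case True
    then have db: "d b = d u" and Hx: "H_par N S < x" by simp_all
    show ?thesis
    proof (cases "u \<in> B")
      case True
      then have ub: "u = b"
        using inj_on_base_set[OF B] b db by (metis inj_onD)
      have "\<forall>i\<in>{1..N} - {d u}. e (i, p u, x) = 0"
      proof
        fix i
        assume "i \<in> {1..N} - {d u}"
        then show "e (i, p u, x) = 0" by (intro base[OF True _ x]) simp_all
      qed
      from cancel[OF x Hx this] have "e (d u, p u, x) = 0" .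
      then show ?thesis unfolding ub .
    next
      case False
      then have uB: "u \<in> {1..K} - B" using u by blast
      \<comment> \<open>The map \<open>\<rho> u\<close> sends \<open>d u\<close> to a base user
        demanding \<open>d u\<close>, and \<open>b\<close> is the only one.\<close>
      have \<rho>b: "\<rho> u (d u) = b"
        using inj_on_base_set[OF B] \<rho>B[OF uB du] b \<rho>[OF uB] db by (metis inj_onD)
      have "\<forall>i\<in>{1..N} - {d u}. e (i, p u, x) = 0"
      proof
        fix i
        assume i: "i \<in> {1..N} - {d u}"
        \<comment> \<open>Base user \<open>\<rho> u i\<close> does not demand file \<open>i\<close>,
          so file \<open>i\<close> is completely decoded in that subfile and the link carries this
          over to subfile \<open>p u\<close>.\<close>
        then have "d (\<rho> u i) \<noteq> i" using \<rho>[OF uB] by blast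
        then have "e (i, p (\<rho> u i), x) = 0" using i by (intro base \<rho>B[OF uB] x) simp_all
        moreover have "e (i, p u, x) = e (i, p (\<rho> u i), x)" using i by (intro linked uB x) simp
        ultimately show "e (i, p u, x) = 0" by (simp only:)
      qed
      from cancel[OF x Hx this] have "e (d u, p u, x) = 0" .
      then show ?thesis unfolding linked[OF uB du x] \<rho>b .
    qed
  qed
  \<comment> \<open>Every subfile is \<open>p c\<close> for some user \<open>c\<close>; for a
    non-base user it is linked to a base subfile, where the labels of file \<open>d u\<close> vanish
    by \<open>wanted\<close>.\<close>
  obtain c where c: "c \<in> {1..K}" "j = p c" using permutes_image[OF p] j by blast
  show ?thesis
  proof (cases "c \<in> B")
    case True
    then show ?thesis using wanted c(2) by simp
  next
    case False
    then have "c \<in> {1..K} - B" using c(1) by blast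
    then show ?thesis unfolding c(2) using linked[OF _ du x] wanted[OF \<rho>B[OF _ du]] by metis
  qed
qed

text \<open>The contributions of the users add up because no request is made on behalf of two of
  them, which is seen from the subfiles that a request touches.\<close>

lemma card_delivery_queries:
  assumes S: "S \<ge> 2" and N: "N \<ge> 2" and p: "p permutes {1..K}" and d: "d ` {1..K} = {1..N}"
    and B: "base_set N K d B" and choices: "user_choices S N K d B P \<rho>"
    and Q: "delivery_queries S N K p d B P \<rho> Q"
  shows "(\<Sum>s=1..S. card (Q s)) = N * q_par N S + (K - N) * (N * S ^ (N - 1))"
proof -
  have BK: "B \<subseteq> {1..K}" and cardB: "card B = N" using B by (simp_all add: base_set_def)
  have finB: "finite B" using BK finite_subset by blast
  obtain Qc where Q1: "\<forall>c\<in>B. QSet1 S N (p c) (P c) (d c) (Qc c)"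
    and Q2: "\<forall>c\<in>{1..K} - B.
        QSet2 S N (\<lambda>i x. sym_diff {(i, p (\<rho> c i), x)} {(i, p c, x)}) (P c) (Qc c)"
    and QU: "Q = (\<lambda>s. \<Union>c\<in>{1..K}. Qc c s)"
    using Q unfolding delivery_queries_def by (elim exE conjE)
  have inj: "\<forall>i\<in>{1..N}. inj (P c i)" if "c \<in> {1..K}" for c
    using choices that permutes_inj unfolding user_choices_def by blast
  have \<rho>B: "\<forall>i\<in>{1..N}. \<rho> c i \<in> B" if "c \<in> {1..K} - B" for c
    using choices that unfolding user_choices_def by blast
  have base: "finite (Qc c s) \<and> (\<Sum>s=1..S. card (Qc c s)) = q_par N S \<and>
      (\<forall>r\<in>Qc c s. (\<exists>l\<in>r. fst (snd l) = p c) \<and> (\<forall>l\<in>r. fst (snd l) = p c))"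
    if c: "c \<in> B" for c s
  proof -
    have cK: "c \<in> {1..K}" using c BK by blast
    then have "d c \<in> {1..N}" using d by blast
    note eff = QSet1_effect[OF bspec[OF Q1 c] S N this inj[OF cK]]
    show ?thesis by (intro conjI ballI eff)
  qed
  have nonbase: "finite (Qc c s) \<and> (\<Sum>s=1..S. card (Qc c s)) = N * S ^ (N - 1) \<and>
      (\<forall>r\<in>Qc c s. (\<exists>l\<in>r. fst (snd l) = p c) \<and> (\<forall>l\<in>r. fst (snd l) \<in> insert (p c) (p ` B)))"
    if c: "c \<in> {1..K} - B" for c s
  proof -
    have cK: "c \<in> {1..K}" using c by blast
    have N1: "1 \<le> N" using N by simp
    have "\<forall>i\<in>{1..N}. p (\<rho> c i) \<noteq> p c"
      using \<rho>B[OF c] c permutes_inj[OF p] by (metis DiffD2 injD)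
    note eff = QSet2_effect[OF bspec[OF Q2 c] S N1 inj[OF cK] this]
    have "insert (p c) ((\<lambda>i. p (\<rho> c i)) ` {1..N}) \<subseteq> insert (p c) (p ` B)"
      using \<rho>B[OF c] by blast
    then show ?thesis by (intro conjI ballI eff(1,2,3) subsetD[OF _ eff(4)])
  qed
  have fin: "finite (Qc c s)" if "c \<in> {1..K}" for c s
    using base[of c s] nonbase[of c s] that by blast
  have own: "\<exists>l\<in>r. fst (snd l) = p c" if "c \<in> {1..K}" "r \<in> Qc c s" for c s r
    using base[of c s] nonbase[of c s] that by blast
  \<comment> \<open>A request made for \<open>c\<close> may touch the subfile of another user
    \<open>c'\<close> only if \<open>c\<close> is non-base and \<open>c'\<close> is base. In that
    case disjointness follows with the roles exchanged.\<close>
  have foreign: "\<not> (\<exists>l\<in>r. fst (snd l) = p c')"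
    if "c \<in> {1..K}" "r \<in> Qc c s" "c \<noteq> c'" "c \<in> B \<or> c' \<notin> B" for c c' s r
  proof -
    have neq: "p c' \<noteq> p c" using permutes_inj[OF p] that(3) by (metis injD)
    show ?thesis
    proof (cases "c \<in> B")
      case True
      then have "\<forall>l\<in>r. fst (snd l) = p c" using base[OF True, of s] that(2) by blast
      then show ?thesis using neq by metis
    next
      case False
      then have "c \<in> {1..K} - B" "p c' \<notin> p ` B"
        using that inj_image_mem_iff[OF permutes_inj[OF p]] by blast+
      moreover from nonbase[OF this(1), of s]
      have "\<forall>l\<in>r. fst (snd l) \<in> insert (p c) (p ` B)" using that(2) by blast
      ultimately show ?thesis using neq by auto
    qed
  qed
  have disj: "Qc c s \<inter> Qc c' s = {}" if "c \<in> {1..K}" "c' \<in> {1..K}" "c \<noteq> c'" for c c' s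
  proof (rule equals0I)
    fix r
    assume r: "r \<in> Qc c s \<inter> Qc c' s"
    show False
    proof (cases "c \<in> B \<or> c' \<notin> B")
      case True
      then show False using foreign[of c r s c'] own[of c' r s] that r by blast
    next
      case False
      then show False using foreign[of c' r s c] own[of c r s] that r by blast
    qed
  qed
  have "(\<Sum>s=1..S. card (Q s)) = (\<Sum>s=1..S. \<Sum>c=1..K. card (Qc c s))"
    unfolding QU using fin disj by (intro sum.cong refl card_UN_disjoint) auto
  also have "\<dots> = (\<Sum>c=1..K. \<Sum>s=1..S. card (Qc c s))" by (rule sum.swap)
  also have "\<dots> = (\<Sum>c\<in>{1..K} - B. \<Sum>s=1..S. card (Qc c s)) + (\<Sum>c\<in>B. \<Sum>s=1..S. card (Qc c s))"
    using BK by (intro sum.subset_diff) simp_all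
  also have "(\<Sum>c\<in>{1..K} - B. \<Sum>s=1..S. card (Qc c s)) = (\<Sum>c\<in>{1..K} - B. N * S ^ (N - 1))"
    using nonbase by (intro sum.cong refl) blast
  also have "(\<Sum>c\<in>B. \<Sum>s=1..S. card (Qc c s)) = (\<Sum>c\<in>B. q_par N S)"
    using base by (intro sum.cong refl) blast
  finally show ?thesis
    using BK finB cardB by (simp add: card_Diff_subset)
qed

lemma delivery_queries_exist:
  assumes "N \<ge> 1" and "d ` {1..K} = {1..N}" and "base_set N K d B"
  shows "\<exists>Q. delivery_queries S N K p d B P \<rho> Q"
proof -
  have "\<forall>c\<in>{1..K}. \<exists>R. if c \<in> B then QSet1 S N (p c) (P c) (d c) R
      else QSet2 S N (\<lambda>i x. sym_diff {(i, p (\<rho> c i), x)} {(i, p c, x)}) (P c) R"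
  proof
    fix c
    assume "c \<in> {1..K}"
    then have "d c \<in> {1..N}" using assms(2) by blast
    then show "\<exists>R. if c \<in> B then QSet1 S N (p c) (P c) (d c) R
        else QSet2 S N (\<lambda>i x. sym_diff {(i, p (\<rho> c i), x)} {(i, p c, x)}) (P c) R"
      using QSet1_exists QSet2_exists[OF assms(1)] by (cases "c \<in> B") simp_all
  qed
  from bchoice[OF this]
  obtain Qc where Qc: "\<forall>c\<in>{1..K}. if c \<in> B then QSet1 S N (p c) (P c) (d c) (Qc c)
      else QSet2 S N (\<lambda>i x. sym_diff {(i, p (\<rho> c i), x)} {(i, p c, x)}) (P c) (Qc c)"
    by (elim exE)
  have "B \<subseteq> {1..K}" using assms(3) by (simp add: base_set_def)
  then have "delivery_queries S N K p d B P \<rho> (\<lambda>s. \<Union>c\<in>{1..K}. Qc c s)"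
    unfolding delivery_queries_def
    by (intro exI[of _ Qc] conjI ballI refl) (use Qc in \<open>auto split: if_splits\<close>)
  then show ?thesis by blast
qed

section \<open>From vanishing differences to recovered files\<close>

text \<open>The decoder picks any valid content consistent with what the user sees. The choice may
  differ from \<open>W\<close>, but not in the demanded file.\<close>

lemma recovers_if_determined:
  assumes "\<And>W W'. valid_files N L W \<Longrightarrow> valid_files N L W' \<Longrightarrow>
      answers S N K L Q W = answers S N K L Q W' \<Longrightarrow> cache S N K L p W u = cache S N K L p W' u \<Longrightarrow>
      W (d u) = W' (d u)"
  shows "recovers S N K L p d Q u"
proof -
  let ?same = "\<lambda>a z W. valid_files N L W \<and> answers S N K L Q W = a \<and> cache S N K L p W u = z"
  have "(SOME W'. ?same (answers S N K L Q W) (cache S N K L p W u) W') (d u) = W (d u)"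
    if "valid_files N L W" for W
  proof -
    have "?same (answers S N K L Q W) (cache S N K L p W u) W" using that by simp
    from someI[of "?same (answers S N K L Q W) (cache S N K L p W u)", OF this]
    show ?thesis using assms[OF _ that] by blast
  qed
  then show ?thesis
    unfolding recovers_def by (intro exI[of _ "\<lambda>a z. (SOME W. ?same a z W) (d u)"]) simp
qed

lemma nth_subsub:
  assumes "length (W i) = L" and "K * S ^ (N - 1) dvd L" and "j \<in> {1..K}" and "x \<in> {1..S ^ (N - 1)}"
    and "n < block S N K L"
  shows "((j - 1) * S ^ (N - 1) + (x - 1)) * block S N K L + n < L"
    and "subsub S N K L W i j x ! n = W i ! (((j - 1) * S ^ (N - 1) + (x - 1)) * block S N K L + n)"
proof -
  let ?b = "block S N K L" and ?y = "(j - 1) * S ^ (N - 1) + (x - 1)"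
  have L: "L = K * S ^ (N - 1) * ?b" using assms(2) unfolding block_def by simp
  have "?y + 1 \<le> (j - 1) * S ^ (N - 1) + S ^ (N - 1)" using assms(4) by simp
  also have "\<dots> = j * S ^ (N - 1)" using assms(3) by (cases j) simp_all
  also have "\<dots> \<le> K * S ^ (N - 1)" using assms(3) by simp
  finally have "(?y + 1) * ?b \<le> L" unfolding L[symmetric] by (subst L) (rule mult_right_mono, simp_all)
  then show lt: "?y * ?b + n < L" using assms(5) by simp
  show "subsub S N K L W i j x ! n = W i ! (?y * ?b + n)"
    unfolding subsub_def using assms(1,5) lt by simp
qed

lemma file_eqI:
  assumes "valid_files N L W" and "valid_files N L W'" and "i \<in> {1..N}" and "K * S ^ (N - 1) dvd L"
    and eq: "\<And>j x n. j \<in> {1..K} \<Longrightarrow> x \<in> {1..S ^ (N - 1)} \<Longrightarrow> n < block S N K L \<Longrightarrow>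
      subsub S N K L W i j x ! n = subsub S N K L W' i j x ! n"
  shows "W i = W' i"
proof (rule nth_equalityI)
  have len: "length (W i) = L" "length (W' i) = L"
    using assms(1-3) by (simp_all add: valid_files_def)
  then show "length (W i) = length (W' i)" by simp
  fix m
  assume "m < length (W i)"
  then have m: "m < L" using len by simp
  let ?b = "block S N K L" and ?P = "S ^ (N - 1)"
  have L: "L = K * ?P * ?b" using assms(4) unfolding block_def by simp
  have "0 < K * ?P * ?b" using m L by linarith
  then have b: "0 < ?b" and P: "0 < ?P" by (simp_all only: nat_0_less_mult_iff)
  \<comment> \<open>Two divisions with remainder invert the index formula of
    \<open>nth_subsub\<close>: \<open>m\<close> by the block size, then the block number
    \<open>y\<close> by \<open>?P\<close>. The added 1 turns quotient and remainder into 1-based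
    labels.\<close>
  define y where "y = m div ?b"
  have "y < K * ?P" unfolding y_def using m L by (simp add: less_mult_imp_div_less)
  then have "y div ?P < K" by (simp add: less_mult_imp_div_less)
  then have jx: "y div ?P + 1 \<in> {1..K}" "y mod ?P + 1 \<in> {1..?P}"
    using P by (simp_all add: Suc_le_eq)
  have n: "m mod ?b < ?b" using b by simp
  have "((y div ?P + 1 - 1) * ?P + (y mod ?P + 1 - 1)) * ?b + m mod ?b = m"
    by (simp only: y_def add_diff_cancel_right' div_mult_mod_eq)
  then show "W i ! m = W' i ! m"
    using eq[OF jx n] nth_subsub(2)[where W = W and i = i, OF len(1) assms(4) jx n]
      nth_subsub(2)[where W = W' and i = i, OF len(2) assms(4) jx n] by simp
qed

theorem theorem2:
  fixes S N K L :: nat and p d :: "nat \<Rightarrow> nat" and B :: "nat set"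
    and P :: "nat \<Rightarrow> nat \<Rightarrow> nat \<Rightarrow> nat" and \<rho> :: "nat \<Rightarrow> nat \<Rightarrow> nat"
    and M R :: real
  assumes "S \<ge> 2" and "2 \<le> N" and "N < K"
    and "L > 0" and "K * S ^ (N - 1) dvd L"
    and "p permutes {1..K}"
    and "d ` {1..K} = {1..N}"
    and "base_set N K d B"
    and "user_choices S N K d B P \<rho>"
    and "M = (real N * real S ^ (N - 1) - real (q_par N S)) / (real K * real S ^ (N - 1))"
    and "R = real N / real K * (real (q_par N S) / real S ^ (N - 1) + real K - real N)"
  shows "(\<exists>Q. delivery_queries S N K p d B P \<rho> Q) \<and>
    (\<forall>Q. delivery_queries S N K p d B P \<rho> Q \<longrightarrow>
       (\<forall>u\<in>{1..K}. recovers S N K L p d Q u) \<and>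
       (\<forall>W. valid_files N L W \<longrightarrow>
          (\<forall>u\<in>{1..K}. real (cache_bits S N K L p W u) = M * real L) \<and>
          real (delivery_bits S N K L Q W) / real L = R))"
proof (intro conjI allI impI ballI)
  have N1: "1 \<le> N" using assms(2) by simp
  show "\<exists>Q. delivery_queries S N K p d B P \<rho> Q"
    using N1 assms(7,8) by (rule delivery_queries_exist)
  let ?b = "block S N K L" and ?P = "S ^ (N - 1)" and ?H = "H_par N S"
  have L: "real L = real K * real S ^ (N - 1) * real ?b"
    using assms(5) unfolding block_def
    by (metis dvd_mult_div_cancel of_nat_mult of_nat_power)
  have pos: "0 < real K" "0 < real S ^ (N - 1)" "0 < real ?b"
    using assms(1,3,4) L by (auto intro!: gr0I)
  fix Q
  assume Q: "delivery_queries S N K p d B P \<rho> Q"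
  have len: "length (xor_sum S N K L W r) = ?b" for W r by (simp add: xor_sum_def)
  show "real (delivery_bits S N K L Q W) / real L = R" for W
  proof -
    have "delivery_bits S N K L Q W = (\<Sum>s=1..S. card (Q s)) * ?b"
      unfolding delivery_bits_def answers_def sum_distrib_right
      by (intro sum.cong refl) (simp add: len)
    then have bits: "real (delivery_bits S N K L Q W)
        = (real N * real (q_par N S) + (real K - real N) * (real N * real S ^ (N - 1))) * real ?b"
      unfolding card_delivery_queries[OF assms(1,2,6-9) Q] using assms(3) by (simp add: of_nat_diff)
    \<comment> \<open>Stated for arbitrary reals, so that field arithmetic sees atoms instead of
      powers and casts.\<close>
    have "(n * q + (k - n) * (n * t)) * b / (k * t * b) = n / k * (q / t + k - n)"
      if "0 < k" "0 < t" "0 < b" for n q k t b :: real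
      using that by (simp add: field_simps)
    from this[OF pos] show ?thesis unfolding bits L assms(11) .
  qed
  fix u
  assume u: "u \<in> {1..K}"
  have pu: "p u \<in> {1..K}" using assms(6) u permutes_in_image by metis
  have cache: "cache S N K L p W u t = xor_sum S N K L W ((\<lambda>i. (i, p u, t)) ` {1..N})"
    if "t \<in> {?H + 1..?P}" for W t
  proof -
    have "{(i, p u, t) |i. i \<in> {1..N}} = (\<lambda>i. (i, p u, t)) ` {1..N}" by blast
    then show ?thesis using that pu unfolding cache_def broadcast_def by simp
  qed
  show "real (cache_bits S N K L p W u) = M * real L" for W
  proof -
    have "cache_bits S N K L p W u = (?P - ?H) * ?b"
      unfolding cache_bits_def using cache len by simp
    moreover have "real (?P - ?H) = real N * real S ^ (N - 1) - real (q_par N S)"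
      using H_par_le[OF assms(1) N1] H_par_exact[OF assms(1) N1] N1
      unfolding H_par_def by (simp add: of_nat_diff algebra_simps)
    ultimately have bits: "real (cache_bits S N K L p W u)
        = (real N * real S ^ (N - 1) - real (q_par N S)) * real ?b"
      by (simp only: of_nat_mult)
    have "y * b = y / (k * t) * (k * t * b)" if "0 < k" "0 < t" for y k t b :: real
      using that by simp
    from this[OF pos(1,2)] show ?thesis unfolding bits L assms(10) .
  qed
  show "recovers S N K L p d Q u"
  proof (rule recovers_if_determined)
    fix W W'
    assume W: "valid_files N L W" "valid_files N L W'"
      and ans: "answers S N K L Q W = answers S N K L Q W'"
      and cch: "cache S N K L p W u = cache S N K L p W' u"
    have "d u \<in> {1..N}" using assms(7) u by blast
    from this assms(5) show "W (d u) = W' (d u)"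
    proof (rule file_eqI[OF W])
      fix j x n
      assume j: "j \<in> {1..K}" and x: "x \<in> {1..?P}" and n: "n < ?b"
      \<comment> \<open>The bit position \<open>n\<close> is fixed. Addition in \<open>bit\<close>
        is also subtraction, so \<open>e\<close> vanishes exactly at the labels where the two
        contents agree in bit \<open>n\<close>.\<close>
      define e where "e l = (case l of (i, j, x) \<Rightarrow>
          subsub S N K L W i j x ! n + subsub S N K L W' i j x ! n)" for l
      have e_sum: "(\<Sum>l\<in>r. e l) = 0" if "xor_sum S N K L W r = xor_sum S N K L W' r" for r
      proof -
        have "xor_sum S N K L W r ! n = xor_sum S N K L W' r ! n" using that by simp
        then have "(\<Sum>(i, j, x)\<in>r. subsub S N K L W i j x ! n)
            = (\<Sum>(i, j, x)\<in>r. subsub S N K L W' i j x ! n)"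
          using n by (simp add: xor_sum_def)
        moreover have "(\<Sum>l\<in>r. e l) = (\<Sum>(i, j, x)\<in>r. subsub S N K L W i j x ! n)
            + (\<Sum>(i, j, x)\<in>r. subsub S N K L W' i j x ! n)"
          unfolding e_def by (simp only: sum.distrib[symmetric] split_def)
        ultimately show ?thesis by (simp only: bit_add_eq_0_iff)
      qed
      have "\<forall>s\<in>{1..S}. \<forall>r\<in>Q s. (\<Sum>l\<in>r. e l) = 0"
      proof (intro ballI)
        fix s r
        assume "s \<in> {1..S}" "r \<in> Q s"
        then show "(\<Sum>l\<in>r. e l) = 0"
          using fun_cong[OF fun_cong[OF ans, of s], of r] by (intro e_sum) (simp add: answers_def)
      qed
      moreover have "\<forall>t\<in>{?H + 1..?P}. (\<Sum>i=1..N. e (i, p u, t)) = 0"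
      proof
        fix t
        assume t: "t \<in> {?H + 1..?P}"
        have "(\<Sum>l\<in>(\<lambda>i. (i, p u, t)) ` {1..N}. e l) = 0"
          using fun_cong[OF cch, of t] unfolding cache[OF t] by (rule e_sum)
        then show "(\<Sum>i=1..N. e (i, p u, t)) = 0"
          by (subst (asm) sum.reindex) (auto intro: inj_onI)
      qed
      ultimately have "e (d u, j, x) = 0"
        using delivery_decoding[OF assms(1,2,6-9) Q _ u _ j x] by blast
      then show "subsub S N K L W (d u) j x ! n = subsub S N K L W' (d u) j x ! n"
        unfolding e_def prod.case bit_add_eq_0_iff .
    qed
  qed
qed

end
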